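(* Let $n\ge 1$ be an integer, let $X_1,\ldots,X_n$ be independent nonnegative real-valued random variables with $\mathbb{E}X_i\le 1$ for every $i$, and put $S=\sum_{i=1}^n X_i$. Then for every real $\delta>0$, $$\mathbb{P}\left(S<\mathbb{E}S+\delta\right)>\begin{cases}\delta e^{-\delta}, & 0<\delta<1,\\[2mm] e^{-1}, & \delta\ge 1.\end{cases}$$
   Context: $\mathbb{P}$ and $\mathbb{E}$ denote probability and expectation. The random variables $X_1,\ldots,X_n$ are not assumed identically distributed. *)

theory Defs
  imports "HOL-Probability.Probability"
begin

end

theory Submission
  imports Defs
begin

text \<open>
Write \<open>m\<^sub>i\<close> for the mean of \<open>X\<^sub>i\<close>. The case \<open>\<delta> > 1\<close> follows from \<open>\<delta> = 1\<close>, because the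
event grows with \<open>\<delta>\<close>; so let \<open>\<delta> \<le> 1\<close>. The bound to prove is then \<open>\<delta> exp (- \<delta>)\<close>.

\<^bold>\<open>Two-point laws.\<close> With all variables but one integrated out, the probability is the expectation of a
function of the remaining variable. For every law on the half-line there is one with the same mean and
at most two atoms that makes this expectation no larger (\<open>two_point_le_expectation\<close>, a
supporting-line argument). Replacing the variables one after the other (\<open>two_point_reduction\<close>)
leaves the case where
\<open>X\<^sub>i\<close> is \<open>m\<^sub>i + k\<^sub>i\<close> with probability \<open>p\<^sub>i\<close> and \<open>m\<^sub>i - w\<^sub>i\<close> otherwise, with \<open>0 \<le> w\<^sub>i \<le> 1\<close>,
\<open>k\<^sub>i \<ge> 0\<close> and \<open>p\<^sub>i k\<^sub>i = (1 - p\<^sub>i) w\<^sub>i\<close>. All probabilities are now finite sums over the set \<open>A\<close> of the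
indices in the upper state, and the event says that the centred sum \<open>dev\<close> is below \<open>\<delta>\<close>.

\<^bold>\<open>Splitting at a scale.\<close> Choose \<open>\<kappa> > 0\<close> and put \<open>\<epsilon> = 1 / \<kappa>\<close>. Ask every index with \<open>k\<^sub>i > \<kappa>\<close> to be in
its lower state. This has probability \<open>\<Prod> 1 / (1 + w\<^sub>i / k\<^sub>i) \<ge> exp (- u)\<close>, where \<open>u = \<Sum> w\<^sub>i / k\<^sub>i\<close>,
and it raises the threshold for the other indices by \<open>\<Sum> w\<^sub>i \<ge> \<kappa> u\<close>. Measured in units of \<open>\<kappa>\<close>, the
other indices have jumps up of size at most \<open>1\<close>, jumps down of size at most \<open>\<epsilon>\<close>, a variance \<open>V\<close>, and
a threshold of at least \<open>\<delta> \<epsilon> + u\<close>.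

\<^bold>\<open>The lower tail of a sum of bounded jumps.\<close> If \<open>V > \<epsilon>\<close>, then such a sum is below \<open>1 + \<epsilon> - V\<close> with
probability larger than \<open>exp (\<epsilon> - V) / (1 + \<epsilon>)\<close> (\<open>lower_tail\<close>). This is shown by Stein's method: an
identity with expectation zero is tested against a function that is adapted to the threshold.
If \<open>\<kappa>\<close> satisfies the balance equation \<open>\<delta> \<epsilon> + u + V = 1 + \<epsilon>\<close>, the two factors multiply to
\<open>exp (\<delta> \<epsilon> - 1) / (1 + \<epsilon>)\<close>, which is at least \<open>\<delta> exp (- \<delta>)\<close>: this is \<open>exp (z - 1) \<ge> z\<close> for
\<open>z = \<delta> (1 + \<epsilon>)\<close>.

\<^bold>\<open>Existence of the scale.\<close> Let \<open>\<kappa>\<close> be the largest scale at which \<open>\<delta> \<epsilon>\<close> plus the sum of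
\<open>w\<^sub>i / k\<^sub>i\<close> over \<open>k\<^sub>i \<ge> \<kappa>\<close> reaches \<open>1\<close>. Beyond it \<open>\<delta> \<epsilon> + u < 1\<close>, so a solution of the balance
equation there has \<open>V > \<epsilon>\<close> as required. By continuity there is one, unless already
\<open>\<delta> \<epsilon> + u + V \<le> 1 + \<epsilon>\<close> at the critical scale itself. In that case \<open>V\<close> is so small there that
Cantelli's inequality can take the place of Stein's method (\<open>bound_at_critical_scale\<close>).
\<close>

section \<open>Independent two-point jumps\<close>

definition bern_wt :: "('i \<Rightarrow> real) \<Rightarrow> 'i set \<Rightarrow> 'i set \<Rightarrow> real" where
  "bern_wt p I A = (\<Prod>i\<in>A. p i) * (\<Prod>i\<in>I - A. 1 - p i)"

text \<open>
The expectation of \<open>f\<close> at the random set that contains each \<open>i \<in> I\<close> independently with probability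
\<open>p i\<close>. A finite sum keeps this half of the proof free of measure theory.
\<close>
definition bern_exp :: "'i set \<Rightarrow> ('i \<Rightarrow> real) \<Rightarrow> ('i set \<Rightarrow> real) \<Rightarrow> real" where
  "bern_exp I p f = (\<Sum>A\<in>Pow I. bern_wt p I A * f A)"

text \<open>
The set \<open>A\<close> collects the indices that jumped up by \<open>k\<close>; all others went down by \<open>w\<close>.
\<close>
definition dev :: "('i \<Rightarrow> real) \<Rightarrow> ('i \<Rightarrow> real) \<Rightarrow> 'i set \<Rightarrow> 'i set \<Rightarrow> real" where
  "dev w k I A = (\<Sum>i\<in>A. k i) - (\<Sum>i\<in>I - A. w i)"

text \<open>
The equation says that every single jump has mean zero. It is written without division so that the
constant jump \<open>k i = w i = 0\<close> is covered for any \<open>p i\<close>.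
\<close>
definition centred :: "'i set \<Rightarrow> ('i \<Rightarrow> real) \<Rightarrow> ('i \<Rightarrow> real) \<Rightarrow> ('i \<Rightarrow> real) \<Rightarrow> bool" where
  "centred I p w k \<longleftrightarrow> finite I \<and>
     (\<forall>i\<in>I. 0 \<le> p i \<and> p i \<le> 1 \<and> 0 \<le> w i \<and> 0 \<le> k i \<and> p i * k i = (1 - p i) * w i)"

lemma bern_exp_empty [simp]: "bern_exp {} p f = f {}"
  by (simp add: bern_exp_def bern_wt_def)

lemma bern_exp_insert:
  assumes "finite I" "j \<notin> I"
  shows "bern_exp (insert j I) p f =
    (1 - p j) * bern_exp I p f + p j * bern_exp I p (\<lambda>A. f (insert j A))"
proof -
  have inj: "inj_on (insert j) (Pow I)"
    using assms(2) by (auto simp: inj_on_def)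
  have dis: "Pow I \<inter> insert j ` Pow I = {}"
    using assms(2) by auto
  have w1: "bern_wt p (insert j I) A = (1 - p j) * bern_wt p I A" if "A \<in> Pow I" for A
  proof -
    have "insert j I - A = insert j (I - A)" using that assms by auto
    then show ?thesis using assms by (simp add: bern_wt_def)
  qed
  have w2: "bern_wt p (insert j I) (insert j A) = p j * bern_wt p I A" if "A \<in> Pow I" for A
  proof -
    have "insert j I - insert j A = I - A" "finite A" "j \<notin> A"
      using that assms finite_subset by auto
    then show ?thesis by (simp add: bern_wt_def)
  qed
  have "bern_exp (insert j I) p f = (\<Sum>A\<in>Pow I. bern_wt p (insert j I) A * f A)
      + (\<Sum>A\<in>Pow I. bern_wt p (insert j I) (insert j A) * f (insert j A))"
    unfolding bern_exp_def Pow_insert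
    using assms dis by (subst sum.union_disjoint) (auto simp: sum.reindex[OF inj])
  also have "\<dots> = (1 - p j) * bern_exp I p f + p j * bern_exp I p (\<lambda>A. f (insert j A))"
    unfolding bern_exp_def sum_distrib_left
    by (intro arg_cong2[of _ _ _ _ "(+)"] sum.cong) (auto simp: w1 w2)
  finally show ?thesis .
qed

lemma bern_exp_add: "bern_exp I p (\<lambda>A. f A + g A) = bern_exp I p f + bern_exp I p g"
  by (simp add: bern_exp_def distrib_left sum.distrib)

lemma bern_exp_cmult: "bern_exp I p (\<lambda>A. c * f A) = c * bern_exp I p f"
  by (simp add: bern_exp_def sum_distrib_left mult.left_commute)

lemma bern_exp_diff: "bern_exp I p (\<lambda>A. f A - g A) = bern_exp I p f - bern_exp I p g"
  by (simp add: bern_exp_def right_diff_distrib sum_subtractf)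

lemma bern_exp_sum: "bern_exp I p (\<lambda>A. \<Sum>i\<in>J. f i A) = (\<Sum>i\<in>J. bern_exp I p (f i))"
  unfolding bern_exp_def sum_distrib_left by (rule sum.swap)

lemma bern_exp_1: "finite I \<Longrightarrow> bern_exp I p (\<lambda>A. 1) = 1"
  by (induction rule: finite_induct) (simp_all add: bern_exp_insert)

lemma bern_exp_const: "finite I \<Longrightarrow> bern_exp I p (\<lambda>A. c) = c"
  using bern_exp_cmult[of I p c "\<lambda>_. 1"] by (simp add: bern_exp_1)

lemma bern_wt_nonneg:
  assumes "\<And>i. i \<in> I \<Longrightarrow> 0 \<le> p i \<and> p i \<le> 1" "A \<subseteq> I"
  shows "0 \<le> bern_wt p I A"
  unfolding bern_wt_def using assms by (intro mult_nonneg_nonneg prod_nonneg) auto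

lemma bern_exp_mono:
  assumes "\<And>i. i \<in> I \<Longrightarrow> 0 \<le> p i \<and> p i \<le> 1" "\<And>A. A \<subseteq> I \<Longrightarrow> f A \<le> g A"
  shows "bern_exp I p f \<le> bern_exp I p g"
  unfolding bern_exp_def
  using assms by (intro sum_mono mult_left_mono bern_wt_nonneg) auto

lemma bern_exp_cong:
  assumes "\<And>A. A \<subseteq> I \<Longrightarrow> f A = g A"
  shows "bern_exp I p f = bern_exp I p g"
  unfolding bern_exp_def using assms by (intro sum.cong) auto

lemma centredD:
  assumes "centred I p w k"
  shows "finite I"
    and "\<And>i. i \<in> I \<Longrightarrow> 0 \<le> p i" "\<And>i. i \<in> I \<Longrightarrow> p i \<le> 1"
    and "\<And>i. i \<in> I \<Longrightarrow> 0 \<le> w i" "\<And>i. i \<in> I \<Longrightarrow> 0 \<le> k i"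
    and "\<And>i. i \<in> I \<Longrightarrow> p i * k i = (1 - p i) * w i"
  using assms by (auto simp: centred_def)

lemma centred_subset: "centred I p w k \<Longrightarrow> J \<subseteq> I \<Longrightarrow> centred J p w k"
  by (auto simp: centred_def intro: finite_subset)

lemma centred_scale:
  assumes "centred I p w k" "0 \<le> c"
  shows "centred I p (\<lambda>i. c * w i) (\<lambda>i. c * k i)"
  using assms unfolding centred_def by (metis mult.left_commute mult_nonneg_nonneg)

lemma dev_scale: "dev (\<lambda>i. c * w i) (\<lambda>i. c * k i) I A = c * dev w k I A"
  by (simp add: dev_def sum_distrib_left right_diff_distrib)

lemma dev_insert_out:
  assumes "finite I" "j \<notin> I" "A \<subseteq> I"
  shows "dev w k (insert j I) A = dev w k I A - w j"
proof -
  have "insert j I - A = insert j (I - A)" using assms by auto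
  then show ?thesis using assms by (simp add: dev_def)
qed

lemma dev_insert_in:
  assumes "finite I" "j \<notin> I" "A \<subseteq> I"
  shows "dev w k (insert j I) (insert j A) = dev w k I A + k j"
proof -
  have "insert j I - insert j A = I - A" "finite A" "j \<notin> A"
    using assms finite_subset by auto
  then show ?thesis by (simp add: dev_def)
qed

text \<open>
Stein's identity for \<open>dev\<close>. For a fixed \<open>i\<close>, remove the own contribution of \<open>i\<close> from \<open>dev\<close> and call
the rest \<open>y\<close>. If \<open>i\<close> is up, then \<open>dev - w i = y + k i - w i\<close>; if it is down, then
\<open>dev + k i = y - w i + k i\<close>. So \<open>h\<close> is evaluated at the same point in both states, and the two
coefficients average to \<open>p i * k i - (1 - p i) * w i = 0\<close>.
\<close>
lemma exchange_identity:
  assumes "centred I p w k"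
  shows "bern_exp I p (\<lambda>A. (\<Sum>i\<in>A. k i * h (dev w k I A - w i))
            - (\<Sum>i\<in>I - A. w i * h (dev w k I A + k i))) = 0"
proof -
  define t where "t i A = (if i \<in> A then k i * h (dev w k I A - w i)
                            else - (w i * h (dev w k I A + k i)))" for i A
  have t0: "bern_exp I p (t i) = 0" if "i \<in> I" for i
  proof -
    define J where "J = I - {i}"
    have J: "finite J" "i \<notin> J" "I = insert i J"
      using that centredD(1)[OF assms] by (auto simp: J_def)
    have "bern_exp J p (t i) = bern_exp J p (\<lambda>A. (- w i) * h (dev w k J A - w i + k i))"
      by (rule bern_exp_cong) (use J in \<open>auto simp: t_def dev_insert_out\<close>)
    moreover have "bern_exp J p (\<lambda>A. t i (insert i A)) =
        bern_exp J p (\<lambda>A. k i * h (dev w k J A - w i + k i))"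
      by (rule bern_exp_cong) (use J in \<open>auto simp: t_def dev_insert_in algebra_simps\<close>)
    ultimately have "bern_exp I p (t i) =
        (p i * k i - (1 - p i) * w i) * bern_exp J p (\<lambda>A. h (dev w k J A - w i + k i))"
      unfolding J(3) bern_exp_insert[OF J(1,2)] bern_exp_cmult by (simp add: algebra_simps)
    then show ?thesis using centredD(6)[OF assms that] by simp
  qed
  have "bern_exp I p (\<lambda>A. (\<Sum>i\<in>A. k i * h (dev w k I A - w i))
            - (\<Sum>i\<in>I - A. w i * h (dev w k I A + k i))) = bern_exp I p (\<lambda>A. \<Sum>i\<in>I. t i A)"
  proof (rule bern_exp_cong)
    fix A assume A: "A \<subseteq> I"
    have "(\<Sum>i\<in>I. t i A) = (\<Sum>i\<in>A. t i A) + (\<Sum>i\<in>I - A. t i A)"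
      using A centredD(1)[OF assms] by (metis add.commute sum.subset_diff)
    moreover have "(\<Sum>i\<in>A. t i A) = (\<Sum>i\<in>A. k i * h (dev w k I A - w i))"
      by (simp add: t_def)
    moreover have "(\<Sum>i\<in>I - A. t i A) = - (\<Sum>i\<in>I - A. w i * h (dev w k I A + k i))"
      unfolding sum_negf[symmetric] by (rule sum.cong) (auto simp: t_def)
    ultimately show "(\<Sum>i\<in>A. k i * h (dev w k I A - w i)) - (\<Sum>i\<in>I - A. w i * h (dev w k I A + k i))
        = (\<Sum>i\<in>I. t i A)"
      by simp
  qed
  then show ?thesis using t0 by (simp add: bern_exp_sum)
qed

lemma variance_split:
  assumes "finite I" "A \<subseteq> I"
  shows "(\<Sum>i\<in>A. k i * w i) + (\<Sum>i\<in>I - A. w i * k i) = (\<Sum>i\<in>I. w i * (k i :: real))"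
  using assms by (simp add: mult.commute sum.subset_diff[of A I])

text \<open>
Both moments come from Stein's identity, with \<open>h = 1\<close> and with \<open>h x = x\<close>.
\<close>
lemma dev_moments:
  assumes "centred I p w k"
  shows "bern_exp I p (dev w k I) = 0"
    and "bern_exp I p (\<lambda>A. (dev w k I A)\<^sup>2) = (\<Sum>i\<in>I. w i * k i)"
proof -
  note fin = centredD(1)[OF assms]
  show "bern_exp I p (dev w k I) = 0"
    using exchange_identity[OF assms, of "\<lambda>_. 1"] by (simp add: dev_def[abs_def])
  have "bern_exp I p (\<lambda>A. (\<Sum>i\<in>A. k i * (dev w k I A - w i))
            - (\<Sum>i\<in>I - A. w i * (dev w k I A + k i))) =
        bern_exp I p (\<lambda>A. (dev w k I A)\<^sup>2 - (\<Sum>i\<in>I. w i * k i))"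
  proof (rule bern_exp_cong)
    fix A assume "A \<subseteq> I"
    from variance_split[OF fin this, of k w]
    show "(\<Sum>i\<in>A. k i * (dev w k I A - w i)) - (\<Sum>i\<in>I - A. w i * (dev w k I A + k i))
        = (dev w k I A)\<^sup>2 - (\<Sum>i\<in>I. w i * k i)"
      by (simp add: dev_def power2_eq_square left_diff_distrib right_diff_distrib distrib_left
          sum_subtractf sum.distrib flip: sum_distrib_right)
  qed
  then show "bern_exp I p (\<lambda>A. (dev w k I A)\<^sup>2) = (\<Sum>i\<in>I. w i * k i)"
    using exchange_identity[OF assms, of "\<lambda>x. x"] fin by (simp add: bern_exp_diff bern_exp_const)
qed

abbreviation below :: "('i \<Rightarrow> real) \<Rightarrow> ('i \<Rightarrow> real) \<Rightarrow> ('i \<Rightarrow> real) \<Rightarrow> 'i set \<Rightarrow> real \<Rightarrow> real" where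
  "below p w k I t \<equiv> bern_exp I p (\<lambda>A. of_bool (dev w k I A < t))"

lemma below_mono:
  assumes "centred I p w k" "s \<le> t"
  shows "below p w k I s \<le> below p w k I t"
  using assms centredD[OF assms(1)] by (intro bern_exp_mono) auto

lemma below_scale:
  assumes "0 < c"
  shows "below p (\<lambda>i. c * w i) (\<lambda>i. c * k i) I (c * t) = below p w k I t"
  using assms by (simp add: dev_scale)

text \<open>
Cantelli's one-sided inequality. Off the event, the quadratic \<open>((x + v / t) / (t + v / t))\<^sup>2\<close> is at
least \<open>1\<close>; the shift \<open>v / t\<close> is the one that makes its expectation smallest.
\<close>
lemma cantelli:
  assumes "centred I p w k" "0 < t"
  shows "t\<^sup>2 / (t\<^sup>2 + (\<Sum>i\<in>I. w i * k i)) \<le> below p w k I t"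
proof -
  define v where "v = (\<Sum>i\<in>I. w i * k i)"
  have v: "0 \<le> v" unfolding v_def using centredD[OF assms(1)] by (intro sum_nonneg) auto
  define s where "s = t + v / t"
  have s: "0 < s" using assms v by (simp add: s_def add_pos_nonneg)
  have "bern_exp I p (\<lambda>A. 1 - (1 / s\<^sup>2) * ((dev w k I A)\<^sup>2 + ((2 * v / t) * dev w k I A + (v / t)\<^sup>2)))
      \<le> below p w k I t"
  proof (rule bern_exp_mono)
    fix A
    have eq: "(1 / s\<^sup>2) * ((dev w k I A)\<^sup>2 + ((2 * v / t) * dev w k I A + (v / t)\<^sup>2))
        = ((dev w k I A + v / t) / s)\<^sup>2"
      by (simp add: power_divide power2_eq_square add_divide_distrib algebra_simps)
    have "1 \<le> ((dev w k I A + v / t) / s)\<^sup>2" if "\<not> dev w k I A < t"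
      using that s by (simp add: s_def)
    then show "1 - (1 / s\<^sup>2) * ((dev w k I A)\<^sup>2 + ((2 * v / t) * dev w k I A + (v / t)\<^sup>2))
        \<le> of_bool (dev w k I A < t)"
      unfolding eq by auto
  qed (use centredD[OF assms(1)] in auto)
  also have "bern_exp I p (\<lambda>A. 1 - (1 / s\<^sup>2) * ((dev w k I A)\<^sup>2 + ((2 * v / t) * dev w k I A + (v / t)\<^sup>2)))
      = 1 - (1 / s\<^sup>2) * (v + (v / t)\<^sup>2)"
    using dev_moments[OF assms(1)] centredD(1)[OF assms(1)]
    by (simp only: bern_exp_diff bern_exp_add bern_exp_cmult bern_exp_const v_def) simp
  also have "\<dots> = t\<^sup>2 / (t\<^sup>2 + v)"
  proof -
    have p: "0 < t\<^sup>2 + v" using assms v by (simp add: add_pos_nonneg)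
    have "s = (t\<^sup>2 + v) / t"
      using assms by (simp add: s_def power2_eq_square add_divide_distrib)
    moreover have "v + (v / t)\<^sup>2 = v * (t\<^sup>2 + v) / t\<^sup>2"
      using assms by (simp add: power2_eq_square field_simps)
    ultimately have "(1 / s\<^sup>2) * (v + (v / t)\<^sup>2) = v * (t\<^sup>2 + v) / (t\<^sup>2 + v)\<^sup>2"
      using assms by (simp add: power_divide)
    also have "\<dots> = v / (t\<^sup>2 + v)" using p by (simp add: power2_eq_square)
    finally show ?thesis using p by (simp add: field_simps)
  qed
  finally show ?thesis by (simp add: v_def)
qed

text \<open>
The left-hand side is the probability that the event occurs with all of \<open>B\<close> in the lower state.
\<close>
lemma drop_coordinates:
  assumes "centred I p w k" "B \<subseteq> I"
  shows "(\<Prod>i\<in>B. 1 - p i) * below p w k (I - B) (t + (\<Sum>i\<in>B. w i)) \<le> below p w k I t"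
proof -
  have "finite B" using assms centredD(1) finite_subset by blast
  then show ?thesis using assms
  proof (induction B arbitrary: t I rule: finite_induct)
    case empty
    then show ?case by simp
  next
    case (insert j B)
    define J where "J = I - {j}"
    have J: "finite J" "j \<notin> J" "I = insert j J" "B \<subseteq> J" "I - insert j B = J - B"
      using insert centredD(1)[OF insert.prems(1)] by (auto simp: J_def)
    have cJ: "centred J p w k" using centred_subset[OF insert.prems(1)] J by auto
    have pj: "0 \<le> p j" "p j \<le> 1" using centredD[OF insert.prems(1)] insert.prems by auto
    have "(1 - p j) * ((\<Prod>i\<in>B. 1 - p i) * below p w k (J - B) (t + w j + (\<Sum>i\<in>B. w i)))
        \<le> (1 - p j) * below p w k J (t + w j)"
      using insert.IH[OF cJ J(4), of "t + w j"] pj by (intro mult_left_mono) auto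
    also have "below p w k J (t + w j) = bern_exp J p (\<lambda>A. of_bool (dev w k I A < t))"
      by (rule bern_exp_cong) (use J in \<open>auto simp: dev_insert_out\<close>)
    also have "(1 - p j) * \<dots> \<le> below p w k I t"
    proof -
      have "bern_exp J p (\<lambda>A. 0) \<le> bern_exp J p (\<lambda>A. of_bool (dev w k I (insert j A) < t))"
        using centredD[OF cJ] by (intro bern_exp_mono) auto
      then show ?thesis
        using pj J(1) unfolding J(3) bern_exp_insert[OF J(1,2)] by (simp add: bern_exp_const)
    qed
    finally show ?case using insert J by (simp add: algebra_simps)
  qed
qed

section \<open>The kernel of the test function\<close>

text \<open>
When all jumps up have size \<open>1\<close> and the jumps down become infinitesimal, \<open>dev + V\<close> becomes a Poisson
variable of mean \<open>V\<close>. The Stein equation \<open>x * f x - V * f (x + 1) = 1\<close> of that law is solved by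
\<open>f x = stein_kernel V (x - 1)\<close>, up to normalisation an incomplete gamma function
(\<open>stein_kernel_recurrence\<close>). In the form of this integral, all comparisons
between values at different arguments reduce to pointwise comparisons of powers of \<open>s\<close>.
\<close>
definition stein_kernel :: "real \<Rightarrow> real \<Rightarrow> real" where
  "stein_kernel V a = integral {0..1} (\<lambda>s. s powr a * exp (V * (1 - s)))"

lemma powr_exp_continuous:
  assumes "0 < (a::real)"
  shows "continuous_on {0..1} (\<lambda>s. s powr a * exp (V * (1 - s)))"
  using assms by (intro continuous_intros continuous_on_powr') auto

lemma stein_kernel_integrable:
  assumes "0 < (a::real)"
  shows "(\<lambda>s. s powr a * exp (V * (1 - s))) integrable_on {0..1}"
  using powr_exp_continuous[OF assms] by (rule integrable_continuous_real)

lemma has_integral_stein_kernel: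
  assumes "0 < (a::real)"
  shows "((\<lambda>s. s powr a * exp (V * (1 - s))) has_integral stein_kernel V a) {0..1}"
  unfolding stein_kernel_def using assms by (intro integrable_integral stein_kernel_integrable)

lemma stein_kernel_nonneg: "0 < a \<Longrightarrow> 0 \<le> stein_kernel V a"
  unfolding stein_kernel_def by (intro integral_nonneg stein_kernel_integrable) auto

lemma stein_kernel_antimono:
  assumes "0 < a" "a \<le> b"
  shows "stein_kernel V b \<le> stein_kernel V a"
  unfolding stein_kernel_def
  using assms
  by (intro integral_le stein_kernel_integrable mult_right_mono powr_mono') auto

lemma stein_kernel_integral_diff:
  assumes "0 < a"
  shows "((\<lambda>s. s powr a * (1 - s) * exp (V * (1 - s))) has_integral
     stein_kernel V a - stein_kernel V (a + 1)) {0..1}"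
proof -
  have "((\<lambda>s. s powr a * exp (V * (1 - s)) - s powr (a + 1) * exp (V * (1 - s))) has_integral
     stein_kernel V a - stein_kernel V (a + 1)) {0..1}"
    unfolding stein_kernel_def
    using assms by (intro has_integral_diff integrable_integral stein_kernel_integrable) auto
  then show ?thesis
    by (rule has_integral_eq[rotated]) (auto simp: powr_add algebra_simps)
qed

text \<open>
Integrate the derivative of \<open>s powr (a + 1) * exp (V * (1 - s))\<close> over the unit interval.
\<close>
lemma stein_kernel_recurrence:
  assumes "0 < a"
  shows "(a + 1) * stein_kernel V a = 1 + V * stein_kernel V (a + 1)"
proof -
  let ?e = "\<lambda>s. exp (V * (1 - s))"
  have "((\<lambda>s. (a + 1) * (s powr a * ?e s) - V * (s powr (a + 1) * ?e s)) has_integral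
      1 powr (a + 1) * ?e 1 - 0 powr (a + 1) * ?e 0) {0..1}"
  proof (rule fundamental_theorem_of_calculus_interior)
    show "continuous_on {0..1} (\<lambda>s. s powr (a + 1) * ?e s)"
      using powr_exp_continuous[of "a + 1"] assms by simp
    fix s :: real assume "s \<in> {0<..<1}"
    then have s: "0 < s" by simp
    have e: "(?e has_real_derivative - V * ?e s) (at s)"
      by (auto intro!: derivative_eq_intros)
    have "((\<lambda>s. s powr (a + 1) * ?e s) has_real_derivative
        (a + 1) * s powr (a + 1 - 1) * ?e s + (- V * ?e s) * s powr (a + 1)) (at s)"
      by (rule DERIV_mult[OF has_real_derivative_powr[OF s] e])
    then show "((\<lambda>s. s powr (a + 1) * ?e s) has_vector_derivative
        (a + 1) * (s powr a * ?e s) - V * (s powr (a + 1) * ?e s)) (at s)"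
      unfolding has_real_derivative_iff_has_vector_derivative[symmetric]
      by (simp add: mult_ac)
  qed auto
  moreover have "((\<lambda>s. (a + 1) * (s powr a * ?e s) - V * (s powr (a + 1) * ?e s)) has_integral
      (a + 1) * stein_kernel V a - V * stein_kernel V (a + 1)) {0..1}"
    unfolding stein_kernel_def using assms
    by (intro has_integral_diff has_integral_mult_right integrable_integral stein_kernel_integrable) auto
  ultimately have "1 powr (a + 1) * ?e 1 - 0 powr (a + 1) * ?e 0 =
      (a + 1) * stein_kernel V a - V * stein_kernel V (a + 1)"
    by (rule has_integral_unique)
  then show ?thesis by simp
qed

lemma stein_kernel_increment_antimono:
  assumes "0 < a" "a \<le> b"
  shows "stein_kernel V b - stein_kernel V (b + 1) \<le> stein_kernel V a - stein_kernel V (a + 1)"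
proof (rule has_integral_le[OF stein_kernel_integral_diff stein_kernel_integral_diff])
  fix s :: real assume "s \<in> {0..1}"
  then show "s powr b * (1 - s) * exp (V * (1 - s)) \<le> s powr a * (1 - s) * exp (V * (1 - s))"
    using assms by (intro mult_right_mono powr_mono') auto
qed (use assms in auto)

lemma powr_ge_chord_below:
  assumes "0 < (s::real)" "s \<le> 1" "0 \<le> w"
  shows "1 + w * (1 - s) \<le> s powr (- w)"
proof -
  have "ln s \<le> s - 1" using assms by (simp add: ln_le_minus_one)
  then have "w * (1 - s) \<le> w * (- ln s)" using assms by (intro mult_left_mono) auto
  then have "1 + w * (1 - s) \<le> exp (w * (- ln s))"
    using exp_ge_add_one_self[of "w * (- ln s)"] by linarith
  then show ?thesis using assms by (simp add: powr_def)
qed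

text \<open>
Lowering the argument by \<open>w\<close> gains at least \<open>w\<close> times the unit increment, since
\<open>s powr (- w) \<ge> 1 + w * (1 - s)\<close> under the integral. Together with the companion upper bound
\<open>stein_kernel_shift_up\<close> this lets jumps of arbitrary size be compared with unit jumps.
\<close>
lemma stein_kernel_shift_down:
  assumes "0 < a - w" "0 \<le> w"
  shows "stein_kernel V a + w * (stein_kernel V a - stein_kernel V (a + 1)) \<le> stein_kernel V (a - w)"
proof (rule has_integral_le)
  show "((\<lambda>s. s powr a * exp (V * (1 - s)) + w * (s powr a * (1 - s) * exp (V * (1 - s)))) has_integral
     stein_kernel V a + w * (stein_kernel V a - stein_kernel V (a + 1))) {0..1}"
    using assms
    by (intro has_integral_add has_integral_mult_right stein_kernel_integral_diff
         has_integral_stein_kernel) auto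
  show "((\<lambda>s. s powr (a - w) * exp (V * (1 - s))) has_integral stein_kernel V (a - w)) {0..1}"
    unfolding stein_kernel_def using assms by (intro integrable_integral stein_kernel_integrable)
  fix s :: real assume s: "s \<in> {0..1}"
  show "s powr a * exp (V * (1 - s)) + w * (s powr a * (1 - s) * exp (V * (1 - s)))
      \<le> s powr (a - w) * exp (V * (1 - s))"
  proof (cases "s = 0")
    case False
    have "s powr a * exp (V * (1 - s)) * (1 + w * (1 - s)) \<le> s powr a * exp (V * (1 - s)) * s powr (- w)"
      using False s assms by (intro mult_left_mono powr_ge_chord_below) auto
    also have "\<dots> = s powr (a - w) * exp (V * (1 - s))"
      by (simp add: powr_diff powr_minus field_simps)
    finally show ?thesis by (simp add: algebra_simps)
  qed auto
qed

lemma powr_le_chord: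
  assumes "0 \<le> (s::real)" "s \<le> 1" "0 \<le> k" "k \<le> 1"
  shows "s powr k \<le> 1 - k * (1 - s)"
proof (cases "s = 0")
  case False
  have "exp ((1 - k) *\<^sub>R 0 + k *\<^sub>R ln s) \<le> (1 - k) * exp 0 + k * exp (ln s)"
    using assms by (intro convex_onD[OF exp_convex]) auto
  then show ?thesis using False assms by (simp add: powr_def algebra_simps)
qed (use assms in auto)

text \<open>
Here \<open>s powr k\<close> is convex in \<open>k\<close> and is compared with its chord over the unit interval, which is
where the bound \<open>k \<le> 1\<close> on the jumps up enters.
\<close>
lemma stein_kernel_shift_up:
  assumes "0 < a" "0 \<le> k" "k \<le> 1"
  shows "stein_kernel V (a + k) \<le> stein_kernel V a - k * (stein_kernel V a - stein_kernel V (a + 1))"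
proof (rule has_integral_le)
  show "((\<lambda>s. s powr a * exp (V * (1 - s)) - k * (s powr a * (1 - s) * exp (V * (1 - s)))) has_integral
     stein_kernel V a - k * (stein_kernel V a - stein_kernel V (a + 1))) {0..1}"
    using assms
    by (intro has_integral_diff has_integral_mult_right stein_kernel_integral_diff
         has_integral_stein_kernel) auto
  show "((\<lambda>s. s powr (a + k) * exp (V * (1 - s))) has_integral stein_kernel V (a + k)) {0..1}"
    unfolding stein_kernel_def using assms by (intro integrable_integral stein_kernel_integrable) auto
  fix s :: real assume s: "s \<in> {0..1}"
  have "s powr a * exp (V * (1 - s)) * s powr k \<le> s powr a * exp (V * (1 - s)) * (1 - k * (1 - s))"
    using s assms by (intro mult_left_mono powr_le_chord) auto
  then show "s powr (a + k) * exp (V * (1 - s))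
      \<le> s powr a * exp (V * (1 - s)) - k * (s powr a * (1 - s) * exp (V * (1 - s)))"
    by (simp add: powr_add algebra_simps)
qed

text \<open>
Every strict inequality in the final bound comes from this one.
\<close>
lemma exp_gt_add_one:
  assumes "x \<noteq> (0::real)"
  shows "1 + x < exp x"
proof (cases "-2 < x")
  case True
  have "1 + x < (1 + x / 2)\<^sup>2"
    using assms zero_less_power2[of x] by (simp add: power2_eq_square algebra_simps)
  also have "\<dots> \<le> (exp (x / 2))\<^sup>2"
    using True exp_ge_add_one_self[of "x / 2"] by (intro power_mono) auto
  also have "\<dots> = exp x"
    by (simp add: power2_eq_square flip: exp_add)
  finally show ?thesis .
next
  case False
  then have "1 + x < 0" by simp
  then show ?thesis using exp_gt_zero[of x] by linarith
qed

lemma exp_diff_quotient_less: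
  assumes "0 < (y::real)"
  shows "exp y - 1 < y * exp y"
proof -
  have "1 - y < exp (- y)"
    using exp_gt_add_one[of "- y"] assms by simp
  then have "(1 - y) * exp y < exp (- y) * exp y" by (intro mult_strict_right_mono) auto
  also have "\<dots> = 1" by (simp flip: exp_add)
  finally show ?thesis by (simp add: left_diff_distrib)
qed

text \<open>
Split off \<open>(s * exp (1 - s)) powr \<epsilon> \<le> 1\<close> from the integrand. What remains is
\<open>s * exp (y * (1 - s))\<close>, whose integral is elementary.
\<close>
lemma stein_kernel_upper:
  assumes "0 < \<epsilon>" "\<epsilon> < V"
  defines "y \<equiv> V - \<epsilon>"
  shows "y\<^sup>2 * stein_kernel V (\<epsilon> + 1) \<le> exp y - 1 - y"
proof -
  have y: "0 < y" using assms by simp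
  have upper: "((\<lambda>s. y\<^sup>2 * (s * exp (y * (1 - s)))) has_integral
      ((- y * 1 - 1) * exp (y * (1 - 1)) - (- y * 0 - 1) * exp (y * (1 - 0)))) {0..1}"
  proof (rule fundamental_theorem_of_calculus)
    fix s :: real
    have "((\<lambda>s. (- y * s - 1) * exp (y * (1 - s))) has_real_derivative
        y\<^sup>2 * (s * exp (y * (1 - s)))) (at s within {0..1})"
      by (auto intro!: derivative_eq_intros simp: algebra_simps power2_eq_square)
    then show "((\<lambda>s. (- y * s - 1) * exp (y * (1 - s))) has_vector_derivative
        y\<^sup>2 * (s * exp (y * (1 - s)))) (at s within {0..1})"
      by (simp add: has_real_derivative_iff_has_vector_derivative)
  qed auto
  have lower: "((\<lambda>s. y\<^sup>2 * (s powr (\<epsilon> + 1) * exp (V * (1 - s)))) has_integral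
      y\<^sup>2 * stein_kernel V (\<epsilon> + 1)) {0..1}"
    unfolding stein_kernel_def using assms
    by (intro has_integral_mult_right integrable_integral stein_kernel_integrable) auto
  have "y\<^sup>2 * (s powr (\<epsilon> + 1) * exp (V * (1 - s))) \<le> y\<^sup>2 * (s * exp (y * (1 - s)))"
    if s: "s \<in> {0..1}" for s
  proof (rule mult_left_mono)
    show "s powr (\<epsilon> + 1) * exp (V * (1 - s)) \<le> s * exp (y * (1 - s))"
    proof (cases "s = 0")
      case False
      then have s0: "0 < s" using s by auto
      have "ln s \<le> s - 1" using s0 by (simp add: ln_le_minus_one)
      then have "\<epsilon> * ln s + \<epsilon> * (1 - s) \<le> 0"
        using mult_left_mono[of "ln s" "s - 1" \<epsilon>] assms by (simp add: algebra_simps)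
      then have "exp (\<epsilon> * ln s + \<epsilon> * (1 - s)) \<le> 1" by simp
      then have "s * exp (y * (1 - s)) * exp (\<epsilon> * ln s + \<epsilon> * (1 - s)) \<le> s * exp (y * (1 - s)) * 1"
        using s0 by (intro mult_left_mono) auto
      moreover have "s powr (\<epsilon> + 1) * exp (V * (1 - s))
          = s * exp (y * (1 - s)) * exp (\<epsilon> * ln s + \<epsilon> * (1 - s))"
      proof -
        have "s powr (\<epsilon> + 1) = s * exp (\<epsilon> * ln s)"
          using s0 powr_add[of s \<epsilon> 1] powr_def[of s \<epsilon>] by simp
        moreover have "exp (V * (1 - s)) = exp (y * (1 - s)) * exp (\<epsilon> * (1 - s))"
          by (simp add: y_def left_diff_distrib flip: exp_add)
        ultimately show ?thesis by (simp add: exp_add)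
      qed
      ultimately show ?thesis by simp
    qed auto
  qed auto
  with lower upper have "y\<^sup>2 * stein_kernel V (\<epsilon> + 1) \<le>
     ((- y * 1 - 1) * exp (y * (1 - 1)) - (- y * 0 - 1) * exp (y * (1 - 0)))"
    by (rule has_integral_le)
  then show ?thesis by simp
qed

section \<open>The lower tail of a sum of bounded jumps\<close>

text \<open>
When \<open>h\<close> near the current value lies on the correct side of the line through \<open>c\<close> with slope \<open>- e\<close>,
the summand of Stein's identity is at least what it is for that line. For a line it depends only on
the value of \<open>dev\<close> and on the variance.
\<close>
lemma exchange_summand_ge_linear:
  fixes w k :: "'i \<Rightarrow> real"
  assumes fin: "finite I" and sub: "A \<subseteq> I"
    and nn: "\<And>i. i \<in> I \<Longrightarrow> 0 \<le> w i \<and> 0 \<le> k i"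
    and dn: "\<And>i. i \<in> A \<Longrightarrow> c + w i * e \<le> h (dev w k I A - w i)"
    and up: "\<And>i. i \<in> I - A \<Longrightarrow> h (dev w k I A + k i) \<le> c - k i * e"
  shows "dev w k I A * c + (\<Sum>i\<in>I. w i * k i) * e \<le>
     (\<Sum>i\<in>A. k i * h (dev w k I A - w i)) - (\<Sum>i\<in>I - A. w i * h (dev w k I A + k i))"
proof -
  have "(\<Sum>i\<in>A. k i * (c + w i * e)) \<le> (\<Sum>i\<in>A. k i * h (dev w k I A - w i))"
    using nn sub dn by (intro sum_mono mult_left_mono) auto
  moreover have "(\<Sum>i\<in>I - A. w i * h (dev w k I A + k i)) \<le> (\<Sum>i\<in>I - A. w i * (c - k i * e))"
    using nn up by (intro sum_mono mult_left_mono) auto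
  moreover have "(\<Sum>i\<in>A. k i * (c + w i * e)) - (\<Sum>i\<in>I - A. w i * (c - k i * e))
      = dev w k I A * c + (\<Sum>i\<in>I. w i * k i) * e"
    unfolding variance_split[OF fin sub, of k w, symmetric]
    by (simp add: dev_def left_diff_distrib right_diff_distrib distrib_left distrib_right
        sum_subtractf sum.distrib sum_distrib_right mult.assoc)
  ultimately show ?thesis by linarith
qed

locale stein_setting =
  fixes \<epsilon> V :: real
  assumes eps_pos: "0 < \<epsilon>" and eps_less: "\<epsilon> < V"
begin

abbreviation R where "R \<equiv> stein_kernel V"

text \<open>
The least constant that the estimate \<open>right_down\<close> allows for jumps down that cross the threshold:
there it has to dominate \<open>R a + w * (R a - R (a + 1))\<close> for all \<open>a \<ge> \<epsilon>\<close> and \<open>w \<le> \<epsilon>\<close>.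
\<close>
definition plateau :: real where
  "plateau = R \<epsilon> + \<epsilon> * (R \<epsilon> - R (\<epsilon> + 1))"

text \<open>
With \<open>Z\<close> the summand of Stein's identity for this function, \<open>Z \<ge> 1\<close> is wanted at or above the
threshold \<open>1 + \<epsilon> - V\<close>, and \<open>Z \<ge> - V * plateau\<close> below it. The kernel makes \<open>Z \<ge> 1\<close> by its
recurrence. Below the threshold, the estimates \<open>middle_down\<close>, \<open>far_down\<close> and \<open>far_up\<close> lead to
\<open>Z \<ge> - (1 - x) * stein_fun x\<close> at \<open>dev = x\<close>. On the plateau this suffices down to \<open>x = 1 - V\<close>; further
down, the function decays in such a way that \<open>(1 - x) * stein_fun x\<close> stays at \<open>V * plateau\<close>.
\<close>
definition stein_fun :: "real \<Rightarrow> real" where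
  "stein_fun x = (if x < 1 - V then V * plateau / (1 - x)
     else if x < 1 + \<epsilon> - V then plateau else R (x - 1 + V))"

lemma plateau_eq: "plateau = 1 + (V - \<epsilon>) * R (\<epsilon> + 1)"
  using stein_kernel_recurrence[OF eps_pos, of V] by (simp add: plateau_def algebra_simps)

lemma increment_nonneg: "0 < a \<Longrightarrow> 0 \<le> R a - R (a + 1)"
  using stein_kernel_antimono[of a "a + 1" V] by simp

lemma kernel_le_plateau: "\<epsilon> \<le> a \<Longrightarrow> R a \<le> plateau"
  using stein_kernel_antimono[OF eps_pos, of a V] increment_nonneg[OF eps_pos]
  by (auto simp: plateau_def intro!: add_increasing2 mult_nonneg_nonneg less_imp_le[OF eps_pos])

lemma plateau_pos: "0 < plateau"
  using stein_kernel_nonneg[of "\<epsilon> + 1" V] eps_pos eps_less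
  by (simp add: plateau_eq add_pos_nonneg)

lemma V_pos: "0 < V" using eps_pos eps_less by simp

text \<open>
Turns the bound \<open>1 / (1 + V * plateau)\<close> that Stein's method gives into the explicit one, by
\<open>plateau \<le> (exp y - 1) / y\<close> with \<open>y = V - \<epsilon>\<close>.
\<close>
lemma plateau_bound: "1 + V * plateau < (1 + \<epsilon>) * exp (V - \<epsilon>)"
proof -
  define y where "y = V - \<epsilon>"
  have y: "0 < y" using eps_less by (simp add: y_def)
  have "y * plateau = y + y\<^sup>2 * R (\<epsilon> + 1)"
    unfolding plateau_eq y_def by (simp add: power2_eq_square algebra_simps)
  also have "\<dots> \<le> exp y - 1"
    using stein_kernel_upper[OF eps_pos eps_less] by (simp add: y_def)
  finally have t: "y * plateau \<le> exp y - 1" .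
  have "y * plateau < y * exp y" using t exp_diff_quotient_less[OF y] by linarith
  then have "plateau < exp y" using y by simp
  then have "\<epsilon> * plateau < \<epsilon> * exp y" using eps_pos by simp
  moreover have "V * plateau = \<epsilon> * plateau + y * plateau" by (simp add: y_def algebra_simps)
  ultimately have "1 + V * plateau < (1 + \<epsilon>) * exp y" using t by (simp add: distrib_right)
  then show ?thesis by (simp add: y_def)
qed

lemma right_down:
  assumes "1 + \<epsilon> - V \<le> x" "0 \<le> w" "w \<le> \<epsilon>"
  defines "a \<equiv> x - 1 + V"
  shows "R a + w * (R a - R (a + 1)) \<le> stein_fun (x - w)"
proof (cases "x - w < 1 + \<epsilon> - V")
  case True
  have a: "\<epsilon> \<le> a" using assms by simp
  have "w * (R a - R (a + 1)) \<le> \<epsilon> * (R \<epsilon> - R (\<epsilon> + 1))"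
    using assms a eps_pos
    by (intro mult_mono stein_kernel_increment_antimono increment_nonneg) auto
  then have "R a + w * (R a - R (a + 1)) \<le> plateau"
    using stein_kernel_antimono[OF eps_pos a, of V] by (simp add: plateau_def)
  then show ?thesis using True assms by (simp add: stein_fun_def)
next
  case False
  then have "R a + w * (R a - R (a + 1)) \<le> R (a - w)"
    using assms eps_pos by (intro stein_kernel_shift_down) auto
  moreover have "stein_fun (x - w) = R (a - w)"
    using False eps_pos by (simp add: stein_fun_def a_def algebra_simps)
  ultimately show ?thesis by simp
qed

lemma right_up:
  assumes "1 + \<epsilon> - V \<le> x" "0 \<le> k" "k \<le> 1"
  defines "a \<equiv> x - 1 + V"
  shows "stein_fun (x + k) \<le> R a - k * (R a - R (a + 1))"
proof -
  have "R (a + k) \<le> R a - k * (R a - R (a + 1))"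
    using assms eps_pos by (intro stein_kernel_shift_up) auto
  moreover have "stein_fun (x + k) = R (a + k)"
    using assms eps_pos by (simp add: stein_fun_def algebra_simps)
  ultimately show ?thesis by simp
qed

lemma fun_le_plateau: "1 - V \<le> x \<Longrightarrow> stein_fun x \<le> plateau"
  using kernel_le_plateau by (simp add: stein_fun_def)

lemma middle_down:
  assumes "1 - V \<le> x" "x < 1 + \<epsilon> - V" "0 \<le> w"
  shows "plateau * (1 - w / V) \<le> stein_fun (x - w)"
proof (cases "x - w < 1 - V")
  case True
  have "0 < 1 - (x - w)" using True V_pos by linarith
  moreover have "(1 - w / V) * (1 - (x - w)) \<le> V"
  proof (cases "w \<le> V")
    case True
    have "(1 - w / V) * (1 - (x - w)) \<le> (1 - w / V) * (V + w)"
      using True assms V_pos by (intro mult_left_mono) auto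
    also have "\<dots> = V - w * w / V" using V_pos by (simp add: field_simps)
    also have "\<dots> \<le> V" using V_pos by simp
    finally show ?thesis .
  next
    case False
    then have "(1 - w / V) * (1 - (x - w)) \<le> 0"
      using V_pos \<open>0 < 1 - (x - w)\<close> by (intro mult_nonpos_nonneg) auto
    then show ?thesis using V_pos by linarith
  qed
  ultimately have "1 - w / V \<le> V / (1 - (x - w))" by (simp add: pos_le_divide_eq)
  then have "plateau * (1 - w / V) \<le> plateau * (V / (1 - (x - w)))"
    using plateau_pos by (intro mult_left_mono) auto
  then show ?thesis using True by (simp add: stein_fun_def mult.commute)
next
  case False
  have "plateau * (1 - w / V) \<le> plateau * 1"
    using plateau_pos assms V_pos by (intro mult_left_mono) auto
  then show ?thesis using False assms by (simp add: stein_fun_def)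
qed

lemma far_down:
  assumes "x < 1 - V" "0 \<le> w"
  shows "V * plateau / (1 - x) * (1 - w / V) \<le> stein_fun (x - w)"
proof -
  have q: "V < 1 - x" "0 < 1 - x" using assms V_pos by auto
  have "(1 - w / V) * (1 - x + w) \<le> 1 - x"
  proof -
    have "1 * w \<le> (1 - x) / V * w" using q V_pos assms by (intro mult_right_mono) auto
    moreover have "0 \<le> w * w / V" using V_pos by simp
    ultimately have "0 \<le> (1 - x) / V * w - w + w * w / V" by simp
    also have "\<dots> = 1 - x - (1 - w / V) * (1 - x + w)"
      using V_pos by (simp add: field_simps)
    finally show ?thesis by simp
  qed
  then have "V * plateau * ((1 - w / V) * (1 - x + w)) \<le> V * plateau * (1 - x)"
    using V_pos plateau_pos by (intro mult_left_mono) auto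
  then have "V * plateau / (1 - x) * (1 - w / V) \<le> V * plateau / (1 - x + w)"
    using q assms by (simp add: divide_simps mult_ac)
  then show ?thesis using assms by (simp add: stein_fun_def algebra_simps)
qed

lemma far_up:
  assumes "x < 1 - V" "0 \<le> k"
  shows "stein_fun (x + k) \<le> V * plateau / (1 - x) * (1 + k / V)"
proof -
  have q: "V < 1 - x" "0 < 1 - x" using assms V_pos by auto
  have eq: "V * plateau / (1 - x) * (1 + k / V) = plateau * (V + k) / (1 - x)"
    using V_pos by (simp add: distrib_left mult.commute)
  show ?thesis
  proof (cases "x + k < 1 - V")
    case True
    then have r: "V < 1 - x - k" by simp
    have "V * (1 - x) \<le> (V + k) * (1 - x - k)"
      using mult_left_mono[of V "1 - x - k" k] r assms by (simp add: algebra_simps)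
    then have "plateau * (V * (1 - x)) \<le> plateau * ((V + k) * (1 - x - k))"
      using plateau_pos by (intro mult_left_mono) auto
    then have "V * plateau / (1 - x - k) \<le> plateau * (V + k) / (1 - x)"
      using q r V_pos by (simp add: divide_simps mult_ac)
    then show ?thesis unfolding eq using True by (simp add: stein_fun_def algebra_simps)
  next
    case False
    have "plateau * (1 - x) \<le> plateau * (V + k)"
      using False plateau_pos by (intro mult_left_mono) auto
    then have "plateau \<le> plateau * (V + k) / (1 - x)" using q by (simp add: pos_le_divide_eq)
    then show ?thesis unfolding eq using False fun_le_plateau[of "x + k"] by simp
  qed
qed

text \<open>
The expectation of \<open>Z\<close> vanishes, while \<open>Z \<ge> 1\<close> outside the event and \<open>Z \<ge> - V * plateau\<close> on it. So
the probability \<open>P\<close> of the event satisfies \<open>1 - P \<le> V * plateau * P\<close>.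
\<close>
lemma lower_tail:
  assumes c: "centred I p w k"
    and w: "\<And>i. i \<in> I \<Longrightarrow> w i \<le> \<epsilon>" and k: "\<And>i. i \<in> I \<Longrightarrow> k i \<le> 1"
    and V: "V = (\<Sum>i\<in>I. w i * k i)"
  shows "exp (\<epsilon> - V) / (1 + \<epsilon>) < below p w k I (1 + \<epsilon> - V)"
proof -
  note cD = centredD[OF c]
  define Z where "Z A = (\<Sum>i\<in>A. k i * stein_fun (dev w k I A - w i))
            - (\<Sum>i\<in>I - A. w i * stein_fun (dev w k I A + k i))" for A
  define P where "P = below p w k I (1 + \<epsilon> - V)"
  have right: "1 \<le> Z A" if A: "A \<subseteq> I" and x: "\<not> dev w k I A < 1 + \<epsilon> - V" for A
  proof -
    define a where "a = dev w k I A - 1 + V"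
    have a: "0 < a" using x eps_pos by (simp add: a_def)
    have "dev w k I A * R a + V * (R a - R (a + 1)) \<le> Z A"
      unfolding V Z_def
      by (rule exchange_summand_ge_linear)
         (use A x w k cD right_down[of "dev w k I A"] right_up[of "dev w k I A"] in
           \<open>auto simp: V[symmetric] a_def\<close>)
    moreover have "dev w k I A * R a + V * (R a - R (a + 1)) = 1"
      using stein_kernel_recurrence[OF a, of V] by (simp add: a_def algebra_simps)
    ultimately show ?thesis by simp
  qed
  have left: "- (V * plateau) \<le> Z A" if A: "A \<subseteq> I" for A
  proof -
    define x where "x = dev w k I A"
    \<comment> \<open>At or above the threshold, on the plateau, and on the hyperbola. In the last two cases the
       line has slope \<open>h / V\<close>, where \<open>h\<close> is the value at \<open>x\<close>.\<close>
    consider "1 + \<epsilon> - V \<le> x" | "1 - V \<le> x" "x < 1 + \<epsilon> - V" | "x < 1 - V" by linarith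
    then show ?thesis
    proof cases
      case 1
      then have "1 \<le> Z A" using right[OF A] by (simp add: x_def)
      moreover have "0 < V * plateau" using V_pos plateau_pos by simp
      ultimately show ?thesis by linarith
    next
      case 2
      have "dev w k I A * plateau + (\<Sum>i\<in>I. w i * k i) * (- plateau / V) \<le> Z A"
        unfolding Z_def
      proof (rule exchange_summand_ge_linear[OF cD(1) A])
        fix i assume "i \<in> A"
        then show "plateau + w i * (- plateau / V) \<le> stein_fun (dev w k I A - w i)"
          using middle_down[OF 2, of "w i"] cD(4)[of i] A by (auto simp: x_def algebra_simps)
      next
        fix i assume i: "i \<in> I - A"
        have "0 \<le> k i * (plateau / V)" using i cD(5) plateau_pos V_pos by simp
        moreover have "stein_fun (dev w k I A + k i) \<le> plateau"
          using 2 i cD(5) by (intro fun_le_plateau) (auto simp: x_def intro: add_increasing2)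
        ultimately show "stein_fun (dev w k I A + k i) \<le> plateau - k i * (- plateau / V)" by simp
      qed (use cD in auto)
      then have "x * plateau - plateau \<le> Z A" using V_pos by (simp add: x_def flip: V)
      moreover have "(1 - x) * plateau \<le> V * plateau" using 2 plateau_pos by (intro mult_right_mono) auto
      ultimately show ?thesis by (simp add: algebra_simps)
    next
      case 3
      define c where "c = V * plateau / (1 - x)"
      have "dev w k I A * c + (\<Sum>i\<in>I. w i * k i) * (- c / V) \<le> Z A"
        unfolding Z_def
      proof (rule exchange_summand_ge_linear[OF cD(1) A])
        fix i assume "i \<in> A"
        then show "c + w i * (- c / V) \<le> stein_fun (dev w k I A - w i)"
          using far_down[OF 3, of "w i"] cD(4)[of i] A
          by (auto simp: right_diff_distrib mult.commute simp flip: x_def c_def)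
      next
        fix i assume "i \<in> I - A"
        then show "stein_fun (dev w k I A + k i) \<le> c - k i * (- c / V)"
          using far_up[OF 3, of "k i"] cD(5)[of i]
          by (auto simp: distrib_left mult.commute simp flip: x_def c_def)
      qed (use cD in auto)
      then have "x * c - c \<le> Z A" using V_pos by (simp add: x_def flip: V)
      moreover have "(1 - x) * c = V * plateau" using 3 V_pos by (simp add: c_def)
      ultimately show ?thesis by (simp add: algebra_simps)
    qed
  qed
  have "bern_exp I p (\<lambda>A. 1 - (1 + V * plateau) * of_bool (dev w k I A < 1 + \<epsilon> - V)) \<le> bern_exp I p Z"
    using cD right left by (intro bern_exp_mono) auto
  also have "bern_exp I p Z = 0"
    unfolding Z_def by (rule exchange_identity[OF c])
  finally have "1 \<le> (1 + V * plateau) * P"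
    using cD(1) unfolding bern_exp_diff bern_exp_cmult P_def by (simp add: bern_exp_const)
  moreover have "0 < 1 + V * plateau" using V_pos plateau_pos by (simp add: add_pos_pos)
  ultimately have "1 / (1 + V * plateau) \<le> P" by (simp add: pos_divide_le_eq mult.commute)
  moreover have "1 / ((1 + \<epsilon>) * exp (V - \<epsilon>)) < 1 / (1 + V * plateau)"
    using plateau_bound \<open>0 < 1 + V * plateau\<close> by (intro divide_strict_left_mono) (auto intro: mult_pos_pos less_trans)
  moreover have "1 / ((1 + \<epsilon>) * exp (V - \<epsilon>)) = exp (\<epsilon> - V) / (1 + \<epsilon>)"
    by (simp add: exp_diff field_simps)
  ultimately show ?thesis by (simp add: P_def)
qed

end

section \<open>Choosing the scale\<close>

lemma scaled_lower_tail:
  assumes c: "centred I p w k" and pos: "0 < \<kappa>"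
    and w: "\<And>i. i \<in> I \<Longrightarrow> w i \<le> 1" and k: "\<And>i. i \<in> I \<Longrightarrow> k i \<le> \<kappa>"
    and V: "V = (\<Sum>i\<in>I. w i * k i) / \<kappa>\<^sup>2" "1 / \<kappa> < V"
  shows "exp (1 / \<kappa> - V) / (1 + 1 / \<kappa>) < below p w k I (\<kappa> * (1 + 1 / \<kappa> - V))"
proof -
  interpret stein_setting "1 / \<kappa>" V
    using pos V by unfold_locales auto
  have "exp (1 / \<kappa> - V) / (1 + 1 / \<kappa>)
      < below p (\<lambda>i. 1 / \<kappa> * w i) (\<lambda>i. 1 / \<kappa> * k i) I (1 + 1 / \<kappa> - V)"
  proof (rule lower_tail)
    show "centred I p (\<lambda>i. 1 / \<kappa> * w i) (\<lambda>i. 1 / \<kappa> * k i)"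
      using c pos by (intro centred_scale) auto
    show "V = (\<Sum>i\<in>I. 1 / \<kappa> * w i * (1 / \<kappa> * k i))"
      unfolding V by (simp add: sum_divide_distrib power2_eq_square)
  qed (use w k pos in \<open>auto simp: divide_simps\<close>)
  also have "\<dots> = below p w k I (\<kappa> * (1 + 1 / \<kappa> - V))"
    using below_scale[where c = "1 / \<kappa>" and p = p and w = w and k = k and I = I
        and t = "\<kappa> * (1 + 1 / \<kappa> - V)"] pos by simp
  finally show ?thesis .
qed

text \<open>
Since \<open>k i \<ge> \<kappa>\<close> on \<open>B\<close>, the gain \<open>w i\<close> in the threshold is at least \<open>\<kappa> * (w i / k i)\<close>. So the one
number \<open>\<Sum>i\<in>B. w i / k i\<close> controls both the cost and the gain of forcing \<open>B\<close> down.
\<close>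
lemma drop_large:
  assumes c: "centred I p w k" and pos: "0 < \<kappa>" and sub: "B \<subseteq> I"
    and k: "\<And>i. i \<in> B \<Longrightarrow> \<kappa> \<le> k i"
  shows "(\<Prod>i\<in>B. 1 / (1 + w i / k i)) *
      below p w k (I - B) (\<kappa> * (\<delta> / \<kappa> + (\<Sum>i\<in>B. w i / k i))) \<le> below p w k I \<delta>"
proof -
  have eq: "1 - p i = 1 / (1 + w i / k i)" if "i \<in> B" for i
  proof -
    have "0 < k i" "0 \<le> w i" "p i * k i = (1 - p i) * w i"
      using that k pos sub centredD[OF c] by (force intro: less_le_trans)+
    then show ?thesis by (simp add: field_simps)
  qed
  have "\<kappa> * (\<Sum>i\<in>B. w i / k i) \<le> (\<Sum>i\<in>B. w i)"
    unfolding sum_distrib_left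
  proof (rule sum_mono)
    fix i assume i: "i \<in> B"
    then have "\<kappa> * w i \<le> k i * w i"
      using k sub centredD[OF c] by (intro mult_right_mono) auto
    then show "\<kappa> * (w i / k i) \<le> w i" using k[OF i] pos by (simp add: field_simps)
  qed
  then have "below p w k (I - B) (\<kappa> * (\<delta> / \<kappa> + (\<Sum>i\<in>B. w i / k i)))
      \<le> below p w k (I - B) (\<delta> + (\<Sum>i\<in>B. w i))"
    using pos by (intro below_mono centred_subset[OF c]) (auto simp: distrib_left)
  then have "(\<Prod>i\<in>B. 1 - p i) * below p w k (I - B) (\<kappa> * (\<delta> / \<kappa> + (\<Sum>i\<in>B. w i / k i)))
      \<le> (\<Prod>i\<in>B. 1 - p i) * below p w k (I - B) (\<delta> + (\<Sum>i\<in>B. w i))"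
    using sub centredD[OF c] by (intro mult_left_mono prod_nonneg) auto
  also have "\<dots> \<le> below p w k I \<delta>"
    by (rule drop_coordinates[OF c sub])
  finally show ?thesis using eq by simp
qed

lemma prod_inverse_ge_exp:
  fixes r :: "'i \<Rightarrow> real"
  assumes "\<And>i. i \<in> B \<Longrightarrow> 0 \<le> r i"
  shows "exp (- (\<Sum>i\<in>B. r i)) \<le> (\<Prod>i\<in>B. 1 / (1 + r i))"
proof (cases "finite B")
  case True
  have "exp (- (\<Sum>i\<in>B. r i)) = (\<Prod>i\<in>B. exp (- r i))"
    using True by (simp add: exp_sum flip: sum_negf)
  also have "\<dots> \<le> (\<Prod>i\<in>B. 1 / (1 + r i))"
  proof (rule prod_mono, intro conjI)
    fix i assume "i \<in> B"
    then have "0 < 1 + r i" using assms by (simp add: add_pos_nonneg)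
    then show "exp (- r i) \<le> 1 / (1 + r i)"
      using exp_ge_add_one_self[of "r i"] by (simp add: exp_minus field_simps)
  qed auto
  finally show ?thesis .
qed auto

lemma prod_inverse_gt_exp:
  fixes r :: "'i \<Rightarrow> real"
  assumes "finite B" "\<And>i. i \<in> B \<Longrightarrow> 0 \<le> r i" "0 < (\<Sum>i\<in>B. r i)"
  shows "exp (- (\<Sum>i\<in>B. r i)) < (\<Prod>i\<in>B. 1 / (1 + r i))"
proof -
  obtain j where j: "j \<in> B" "0 < r j"
    using assms by (metis less_eq_real_def sum.neutral order_less_irrefl)
  have "exp (- (\<Sum>i\<in>B. r i)) = exp (- r j) * exp (- (\<Sum>i\<in>B - {j}. r i))"
    using j assms(1) by (simp add: sum.remove exp_add[symmetric])
  also have "\<dots> < 1 / (1 + r j) * exp (- (\<Sum>i\<in>B - {j}. r i))"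
    using exp_gt_add_one[of "r j"] j
    by (intro mult_strict_right_mono) (auto simp: exp_minus field_simps)
  also have "\<dots> \<le> 1 / (1 + r j) * (\<Prod>i\<in>B - {j}. 1 / (1 + r i))"
    using j assms(2) by (intro mult_left_mono prod_inverse_ge_exp) auto
  also have "\<dots> = (\<Prod>i\<in>B. 1 / (1 + r i))"
    using j assms(1) by (simp add: prod.remove)
  finally show ?thesis .
qed

text \<open>
Equality holds only for \<open>\<delta> * (1 + \<epsilon>) = 1\<close>, as the strict variant \<open>target_less\<close> records.
\<close>
lemma target_le:
  fixes \<delta> \<epsilon> :: real
  assumes "0 < \<epsilon>"
  shows "\<delta> * exp (- \<delta>) \<le> exp (\<delta> * \<epsilon> - 1) / (1 + \<epsilon>)"
proof -
  have "\<delta> * (1 + \<epsilon>) \<le> exp (\<delta> * (1 + \<epsilon>) - 1)"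
    using exp_ge_add_one_self[of "\<delta> * (1 + \<epsilon>) - 1"] by simp
  also have "\<dots> = exp (\<delta> * \<epsilon> - 1) * exp \<delta>"
    by (simp add: algebra_simps flip: exp_add)
  finally show ?thesis using assms by (simp add: exp_minus field_simps)
qed

lemma target_less:
  fixes \<delta> \<epsilon> :: real
  assumes "0 < \<epsilon>" "\<delta> * (1 + \<epsilon>) \<noteq> 1"
  shows "\<delta> * exp (- \<delta>) < exp (\<delta> * \<epsilon> - 1) / (1 + \<epsilon>)"
proof -
  have "\<delta> * (1 + \<epsilon>) < exp (\<delta> * (1 + \<epsilon>) - 1)"
    using exp_gt_add_one[of "\<delta> * (1 + \<epsilon>) - 1"] assms by simp
  also have "\<dots> = exp (\<delta> * \<epsilon> - 1) * exp \<delta>"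
    by (simp add: algebra_simps flip: exp_add)
  finally show ?thesis using assms by (simp add: exp_minus field_simps)
qed

text \<open>
The balance equation \<open>bal\<close> makes the available threshold \<open>\<delta> / \<kappa> + u\<close> equal to the threshold
\<open>1 + 1 / \<kappa> - V\<close> of Stein's bound, and \<open>lt\<close> then says that \<open>V > 1 / \<kappa>\<close>.
\<close>
lemma bound_at_balanced_scale:
  assumes c: "centred I p w k" and pos: "0 < \<kappa>" and w: "\<And>i. i \<in> I \<Longrightarrow> w i \<le> 1"
    and u: "u = (\<Sum>i\<in>{i\<in>I. \<kappa> < k i}. w i / k i)"
    and V: "V = (\<Sum>i\<in>{i\<in>I. k i \<le> \<kappa>}. w i * k i) / \<kappa>\<^sup>2"
    and lt: "\<delta> / \<kappa> + u < 1" and bal: "\<delta> / \<kappa> + u + V = 1 + 1 / \<kappa>"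
  shows "\<delta> * exp (- \<delta>) < below p w k I \<delta>"
proof -
  define B where "B = {i\<in>I. \<kappa> < k i}"
  have G: "I - B = {i\<in>I. k i \<le> \<kappa>}" by (auto simp: B_def)
  have cG: "centred (I - B) p w k" using centred_subset[OF c] by auto
  have "\<delta> * exp (- \<delta>) \<le> exp (\<delta> * (1 / \<kappa>) - 1) / (1 + 1 / \<kappa>)"
    using pos by (intro target_le) auto
  also have "\<dots> = exp (- u) * (exp (1 / \<kappa> - V) / (1 + 1 / \<kappa>))"
  proof -
    have "\<delta> * (1 / \<kappa>) - 1 = - u + (1 / \<kappa> - V)" using bal by simp
    then show ?thesis by (simp only: exp_add times_divide_eq_right)
  qed
  also have "\<dots> < exp (- u) * below p w k (I - B) (\<kappa> * (1 + 1 / \<kappa> - V))"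
    using pos w lt bal V cG unfolding G
    by (intro mult_strict_left_mono scaled_lower_tail) auto
  also have "\<dots> \<le> (\<Prod>i\<in>B. 1 / (1 + w i / k i)) * below p w k (I - B) (\<kappa> * (1 + 1 / \<kappa> - V))"
  proof (rule mult_right_mono)
    show "exp (- u) \<le> (\<Prod>i\<in>B. 1 / (1 + w i / k i))"
      unfolding u B_def[symmetric] using centredD[OF c]
      by (intro prod_inverse_ge_exp) (auto simp: B_def)
    have "bern_exp (I - B) p (\<lambda>A. 0) \<le> below p w k (I - B) (\<kappa> * (1 + 1 / \<kappa> - V))"
      using centredD[OF cG] by (intro bern_exp_mono) auto
    then show "0 \<le> below p w k (I - B) (\<kappa> * (1 + 1 / \<kappa> - V))"
      using centredD[OF cG] by (simp add: bern_exp_const)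
  qed
  also have "1 + 1 / \<kappa> - V = \<delta> / \<kappa> + (\<Sum>i\<in>B. w i / k i)"
    using bal u by (simp add: B_def)
  also have "(\<Prod>i\<in>B. 1 / (1 + w i / k i)) *
      below p w k (I - B) (\<kappa> * (\<delta> / \<kappa> + (\<Sum>i\<in>B. w i / k i))) \<le> below p w k I \<delta>"
    using c pos by (intro drop_large) (auto simp: B_def)
  finally show ?thesis .
qed

text \<open>
At the largest variance \<open>\<epsilon> - b\<close> that is admitted, Cantelli's inequality gives
\<open>(1 + b)\<^sup>2 / ((1 + b)\<^sup>2 + \<epsilon> - b)\<close>, and \<open>b \<le> \<epsilon>\<close> makes this at least the stated bound.
\<close>
lemma cantelli_scaled:
  assumes c: "centred I p w k" and pos: "0 < \<kappa>" and b: "0 \<le> b"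
    and V: "(\<Sum>i\<in>I. w i * k i) / \<kappa>\<^sup>2 \<le> \<epsilon> - b"
  shows "(1 + b) / (1 + \<epsilon>) \<le> below p w k I (\<kappa> * (1 + b))"
proof -
  define W where "W = (\<Sum>i\<in>I. w i * k i) / \<kappa>\<^sup>2"
  have W: "0 \<le> W" "W \<le> \<epsilon> - b"
    unfolding W_def using centredD[OF c] V by (auto intro!: divide_nonneg_nonneg sum_nonneg)
  have eq: "(\<Sum>i\<in>I. w i * k i) = \<kappa>\<^sup>2 * W" using pos by (simp add: W_def)
  have q: "0 < (1 + b)\<^sup>2 + W" using W b by (intro add_pos_nonneg) auto
  have "b * b \<le> b * \<epsilon>" using W b by (intro mult_left_mono) auto
  then have "(1 + b)\<^sup>2 + W \<le> (1 + b) * (1 + \<epsilon>)"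
    using W by (simp add: power2_eq_square algebra_simps)
  then have "(1 + b) * ((1 + b)\<^sup>2 + W) \<le> (1 + b) * ((1 + b) * (1 + \<epsilon>))"
    using b by (intro mult_left_mono) auto
  then have "(1 + b) / (1 + \<epsilon>) \<le> (1 + b)\<^sup>2 / ((1 + b)\<^sup>2 + W)"
    using q b W by (simp add: divide_simps power2_eq_square mult_ac)
  also have "\<dots> = (\<kappa> * (1 + b))\<^sup>2 / ((\<kappa> * (1 + b))\<^sup>2 + \<kappa>\<^sup>2 * W)"
    using pos by (simp add: power_mult_distrib flip: distrib_left)
  also have "\<dots> \<le> below p w k I (\<kappa> * (1 + b))"
    unfolding eq[symmetric] using pos b by (intro cantelli c) auto
  finally show ?thesis .
qed

text \<open>
Indices with \<open>k i = \<kappa>\<close> may be treated as large or as small: moving one of them from small to large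
takes \<open>w i / k i\<close> from \<open>V\<close> and adds it to \<open>u\<close>. So \<open>\<delta> / \<kappa> + u + V \<le> 1 + 1 / \<kappa>\<close> persists while a
minimal set \<open>E\<close> of them is moved to bring \<open>\<delta> / \<kappa> + u\<close> up to \<open>1 + b\<close> with \<open>b \<ge> 0\<close>. Cantelli's
inequality for the small ones gives \<open>(1 + b) / (1 + 1 / \<kappa>)\<close>. The overshoot \<open>b\<close> costs nothing: by
minimality it is less than \<open>r j\<close> for each \<open>j \<in> E\<close>, and \<open>(1 + b) / (1 + r j)\<close> exceeds \<open>exp (b - r j)\<close>.
If \<open>E\<close> is empty, then \<open>b = 0\<close>, and strictness comes from the large indices or from \<open>target_less\<close>.
\<close>
lemma bound_at_critical_scale:
  assumes c: "centred I p w k" and pos: "0 < \<kappa>" and \<delta>: "0 < \<delta>"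
    and reach: "1 \<le> (\<Sum>i\<in>{i\<in>I. \<kappa> \<le> k i}. w i / k i) + \<delta> / \<kappa>"
    and below1: "(\<Sum>i\<in>{i\<in>I. \<kappa> < k i}. w i / k i) + \<delta> / \<kappa> \<le> 1"
    and bal: "\<delta> / \<kappa> + (\<Sum>i\<in>{i\<in>I. \<kappa> < k i}. w i / k i)
        + (\<Sum>i\<in>{i\<in>I. k i \<le> \<kappa>}. w i * k i) / \<kappa>\<^sup>2 \<le> 1 + 1 / \<kappa>"
  shows "\<delta> * exp (- \<delta>) < below p w k I \<delta>"
proof -
  define r where "r i = w i / k i" for i
  define B0 where "B0 = {i\<in>I. \<kappa> < k i}"
  define K where "K = {i\<in>I. k i = \<kappa>}"
  define \<epsilon> where "\<epsilon> = 1 / \<kappa>"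
  note cD = centredD[OF c]
  have eps: "0 < \<epsilon>" using pos by (simp add: \<epsilon>_def)
  have fin: "finite B0" "finite K" using cD by (auto simp: B0_def K_def)
  have r0: "0 \<le> r i" if "i \<in> I" for i using cD that by (simp add: r_def)
  define S where "S = {E. E \<subseteq> K \<and> 1 \<le> sum r B0 + sum r E + \<delta> / \<kappa>}"
  have "{i\<in>I. \<kappa> \<le> k i} = B0 \<union> K" "B0 \<inter> K = {}" by (auto simp: B0_def K_def)
  then have "K \<in> S" using reach fin by (simp add: S_def sum.union_disjoint r_def)
  moreover have "finite S" using fin by (simp add: S_def)
  ultimately obtain E where E: "E \<in> S" and minE: "\<And>F. F \<in> S \<Longrightarrow> F \<subseteq> E \<Longrightarrow> F = E"
    using finite_has_minimal[of S] by blast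
  define B where "B = B0 \<union> E"
  define b where "b = sum r B + \<delta> / \<kappa> - 1"
  have EK: "E \<subseteq> K" using E by (simp add: S_def)
  have finE: "finite E" using EK fin finite_subset by blast
  have disj: "B0 \<inter> E = {}" using EK by (auto simp: B0_def K_def)
  have sumB: "sum r B = sum r B0 + sum r E"
    using disj fin finE by (simp add: B_def sum.union_disjoint)
  have BI: "B \<subseteq> I" "finite B" using EK fin finE by (auto simp: B_def B0_def K_def)
  have b0: "0 \<le> b" using E by (simp add: S_def b_def sumB)
  have kB: "\<kappa> \<le> k i" if "i \<in> B" for i using that EK by (auto simp: B_def B0_def K_def)
  have cG: "centred (I - B) p w k" using centred_subset[OF c] by auto
  have "(\<Sum>i\<in>I - B. w i * k i) / \<kappa>\<^sup>2 \<le> \<epsilon> - b"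
  proof -
    have eq: "{i\<in>I. k i \<le> \<kappa>} = (I - B) \<union> E" "(I - B) \<inter> E = {}"
      using EK by (auto simp: B_def B0_def K_def)
    have "(\<Sum>i\<in>E. w i * k i) = (\<Sum>i\<in>E. \<kappa>\<^sup>2 * r i)"
      by (rule sum.cong) (use EK pos in \<open>auto simp: r_def K_def power2_eq_square\<close>)
    then have "(\<Sum>i\<in>E. w i * k i) / \<kappa>\<^sup>2 = sum r E"
      using pos by (simp flip: sum_distrib_left)
    then have "(\<Sum>i\<in>{i\<in>I. k i \<le> \<kappa>}. w i * k i) / \<kappa>\<^sup>2 = (\<Sum>i\<in>I - B. w i * k i) / \<kappa>\<^sup>2 + sum r E"
      using cD(1) finE eq(2) unfolding eq(1) by (simp add: sum.union_disjoint add_divide_distrib)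
    then show ?thesis using bal unfolding b_def sumB \<epsilon>_def B0_def r_def by simp
  qed
  from cantelli_scaled[OF cG pos b0 this]
  have G: "(1 + b) / (1 + \<epsilon>) \<le> below p w k (I - B) (\<kappa> * (1 + b))" .
  have prod0: "0 \<le> (\<Prod>i\<in>B. 1 / (1 + r i))"
    using BI r0 by (intro prod_nonneg) auto
  have "(\<Prod>i\<in>B. 1 / (1 + r i)) * ((1 + b) / (1 + \<epsilon>))
      \<le> (\<Prod>i\<in>B. 1 / (1 + r i)) * below p w k (I - B) (\<kappa> * (1 + b))"
    using G prod0 by (rule mult_left_mono)
  also have "1 + b = \<delta> / \<kappa> + (\<Sum>i\<in>B. w i / k i)"
    by (simp add: b_def r_def)
  also have "(\<Prod>i\<in>B. 1 / (1 + r i)) *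
      below p w k (I - B) (\<kappa> * (\<delta> / \<kappa> + (\<Sum>i\<in>B. w i / k i))) \<le> below p w k I \<delta>"
    unfolding r_def by (rule drop_large[OF c pos BI(1) kB])
  finally have main: "(\<Prod>i\<in>B. 1 / (1 + r i)) * ((1 + b) / (1 + \<epsilon>)) \<le> below p w k I \<delta>"
    by (simp add: b_def r_def add.commute)
  show ?thesis
  proof (cases "E = {}")
    case False
    then obtain j where j: "j \<in> E" by auto
    have "\<not> 1 \<le> sum r B0 + sum r (E - {j}) + \<delta> / \<kappa>"
      using minE[of "E - {j}"] j EK by (auto simp: S_def)
    then have bj: "b < r j"
      using j finE by (simp add: b_def sumB sum_diff1)
    define a where "a = r j - b"
    have rest: "sum r (B - {j}) = 1 - a - \<delta> * \<epsilon>"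
    proof -
      have "j \<in> B" using j by (simp add: B_def)
      then have "sum r (B - {j}) = sum r B - r j" using BI by (simp add: sum_diff1)
      then show ?thesis by (simp add: a_def b_def \<epsilon>_def)
    qed
    have "\<delta> * exp (- \<delta>) \<le> exp (\<delta> * \<epsilon> - 1) / (1 + \<epsilon>)"
      using eps by (rule target_le)
    also have "exp (\<delta> * \<epsilon> - 1) = exp (- a) * exp (- sum r (B - {j}))"
      unfolding rest by (simp flip: exp_add)
    also have "exp (- a) * exp (- sum r (B - {j})) / (1 + \<epsilon>)
        < (1 / (1 + r j) * (1 + b)) * exp (- sum r (B - {j})) / (1 + \<epsilon>)"
    proof (intro divide_strict_right_mono mult_strict_right_mono)
      have a: "0 < a" and rj: "r j = a + b" using bj by (simp_all add: a_def)
      have "1 + r j \<le> (1 + a) * (1 + b)"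
        using mult_nonneg_nonneg[of a b] a b0 by (simp add: rj distrib_left distrib_right)
      also have "\<dots> < exp a * (1 + b)"
        using exp_gt_add_one[of a] a b0 by (intro mult_strict_right_mono) auto
      finally show "exp (- a) < 1 / (1 + r j) * (1 + b)"
        using b0 bj by (simp add: exp_minus divide_simps mult_ac)
    qed (use eps in auto)
    also have "\<dots> \<le> (1 / (1 + r j) * (1 + b)) * (\<Prod>i\<in>B - {j}. 1 / (1 + r i)) / (1 + \<epsilon>)"
      using b0 bj eps BI r0
      by (intro divide_right_mono mult_left_mono prod_inverse_ge_exp) auto
    also have "\<dots> = (\<Prod>i\<in>B. 1 / (1 + r i)) * ((1 + b) / (1 + \<epsilon>))"
    proof -
      have "j \<in> B" using j by (simp add: B_def)
      then show ?thesis using BI(2) by (subst prod.remove[of B j]) auto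
    qed
    finally show ?thesis using main by linarith
  next
    case True
    then have B: "B = B0" by (simp add: B_def)
    have "b = 0" using b0 below1 by (simp add: b_def B B0_def r_def)
    then have u: "sum r B = 1 - \<delta> * \<epsilon>" by (simp add: b_def \<epsilon>_def)
    show ?thesis
    proof (cases "0 < sum r B")
      case True
      have "\<delta> * exp (- \<delta>) \<le> exp (\<delta> * \<epsilon> - 1) / (1 + \<epsilon>)"
        using eps by (rule target_le)
      also have "\<dots> < (\<Prod>i\<in>B. 1 / (1 + r i)) / (1 + \<epsilon>)"
        using prod_inverse_gt_exp[of B r] True BI r0 u eps
        by (intro divide_strict_right_mono) auto
      finally show ?thesis using main \<open>b = 0\<close> by simp
    next
      case False
      moreover have "0 \<le> sum r B" using BI r0 by (intro sum_nonneg) auto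
      ultimately have s: "sum r B = 0" by simp
      then have "\<delta> * \<epsilon> = 1" using u by simp
      \<comment> \<open>Now \<open>\<delta> * (1 + \<epsilon>) = \<delta> + 1\<close> is not \<open>1\<close>.\<close>
      have "\<delta> * exp (- \<delta>) < exp (\<delta> * \<epsilon> - 1) / (1 + \<epsilon>)"
        using eps \<open>\<delta> * \<epsilon> = 1\<close> \<delta> by (intro target_less) (auto simp: distrib_left)
      also have "\<dots> \<le> (\<Prod>i\<in>B. 1 / (1 + r i)) / (1 + \<epsilon>)"
        using prod_inverse_ge_exp[of B r] BI r0 u eps
        by (intro divide_right_mono) auto
      finally show ?thesis using main \<open>b = 0\<close> by simp
    qed
  qed
qed

text \<open>
The scale is the supremum of all \<open>s\<close> where the sum over \<open>k i \<ge> s\<close>, plus \<open>\<delta> / s\<close>, reaches \<open>1\<close>. The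
supremum is attained because this sum is left-continuous in \<open>s\<close>; its limit from the right at \<open>\<kappa>\<close> is
the sum over \<open>k i > \<kappa>\<close>.
\<close>
lemma critical_scale_exists:
  fixes r k :: "'i \<Rightarrow> real"
  assumes fin: "finite I" and r: "\<And>i. i \<in> I \<Longrightarrow> 0 \<le> r i" and \<delta>: "0 < \<delta>"
  obtains \<kappa> where "0 < \<kappa>" "1 \<le> (\<Sum>i\<in>{i\<in>I. \<kappa> \<le> k i}. r i) + \<delta> / \<kappa>"
    "\<And>s. \<kappa> < s \<Longrightarrow> (\<Sum>i\<in>{i\<in>I. s \<le> k i}. r i) + \<delta> / s < 1"
    "(\<Sum>i\<in>{i\<in>I. \<kappa> < k i}. r i) + \<delta> / \<kappa> \<le> 1"
proof -
  define g where "g s = (\<Sum>i\<in>{i\<in>I. s \<le> k i}. r i) + \<delta> / s" for s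
  define C where "C = {s. 0 < s \<and> 1 \<le> g s}"
  have "0 \<le> (\<Sum>i\<in>{i\<in>I. \<delta> \<le> k i}. r i)" using r by (intro sum_nonneg) auto
  then have dC: "\<delta> \<in> C" using \<delta> by (simp add: C_def g_def)
  have bdd: "bdd_above C"
  proof (rule bdd_aboveI)
    fix s assume s: "s \<in> C"
    show "s \<le> \<delta> + (\<Sum>i\<in>I. \<bar>k i\<bar>)"
    proof (rule ccontr)
      assume n: "\<not> s \<le> \<delta> + (\<Sum>i\<in>I. \<bar>k i\<bar>)"
      have "k i < s" if "i \<in> I" for i
      proof -
        have "\<bar>k i\<bar> \<le> (\<Sum>i\<in>I. \<bar>k i\<bar>)" using that fin by (intro member_le_sum) auto
        then show ?thesis using n \<delta> by linarith
      qed
      then have e: "{i\<in>I. s \<le> k i} = {}" by force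
      have "0 \<le> (\<Sum>i\<in>I. \<bar>k i\<bar>)" by (intro sum_nonneg) auto
      then have "\<delta> < s" using n by linarith
      then have "g s < 1" unfolding g_def e using \<delta> by simp
      then show False using s by (simp add: C_def)
    qed
  qed
  define \<kappa> where "\<kappa> = Sup C"
  have k0: "0 < \<kappa>" using cSup_upper[OF dC bdd] \<delta> by (simp add: \<kappa>_def)
  have above: "g s < 1" if "\<kappa> < s" for s
    using cSup_upper[OF _ bdd, of s] that k0 by (force simp: C_def \<kappa>_def)
  have lim: "((\<lambda>s. x + \<delta> / s) \<longlongrightarrow> x + \<delta> / \<kappa>) (at \<kappa> within T)" for x T
    using k0 by (intro tendsto_intros) auto
  have reach: "1 \<le> g \<kappa>"
  proof (rule ccontr)
    assume n: "\<not> 1 \<le> g \<kappa>"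
    have "\<forall>\<^sub>F s in at_left \<kappa>. \<forall>i\<in>I. s \<le> k i \<longrightarrow> \<kappa> \<le> k i"
    proof (intro eventually_ball_finite fin ballI)
      fix i
      show "\<forall>\<^sub>F s in at_left \<kappa>. s \<le> k i \<longrightarrow> \<kappa> \<le> k i"
      proof (cases "\<kappa> \<le> k i")
        case False
        then show ?thesis
          by (intro eventually_mono[OF eventually_at_left_field[THEN iffD2]]) (auto intro!: exI[of _ "k i"])
      qed auto
    qed
    moreover have "\<forall>\<^sub>F s in at_left \<kappa>. (\<Sum>i\<in>{i\<in>I. \<kappa> \<le> k i}. r i) + \<delta> / s < 1"
      using n by (intro order_tendstoD(2)[OF lim]) (auto simp: g_def)
    ultimately have "\<forall>\<^sub>F s in at_left \<kappa>. (\<forall>i\<in>I. s \<le> k i \<longrightarrow> \<kappa> \<le> k i) \<and>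
        (\<Sum>i\<in>{i\<in>I. \<kappa> \<le> k i}. r i) + \<delta> / s < 1"
      by (rule eventually_conj)
    then obtain l where l: "l < \<kappa>"
      "\<And>s. l < s \<Longrightarrow> s < \<kappa> \<Longrightarrow> (\<forall>i\<in>I. s \<le> k i \<longrightarrow> \<kappa> \<le> k i) \<and>
        (\<Sum>i\<in>{i\<in>I. \<kappa> \<le> k i}. r i) + \<delta> / s < 1"
      unfolding eventually_at_left_field by blast
    obtain s where s: "s \<in> C" "l < s"
      using less_cSup_iff[of C l] dC bdd l(1) by (auto simp: \<kappa>_def)
    have sk: "s \<le> \<kappa>" using cSup_upper[OF s(1) bdd] by (simp add: \<kappa>_def)
    show False
    proof (cases "s = \<kappa>")
      case False
      then have "s < \<kappa>" using sk by simp
      from l(2)[OF s(2) this] have "{i\<in>I. s \<le> k i} = {i\<in>I. \<kappa> \<le> k i}"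
        using sk by force
      then show False using l(2)[OF s(2) \<open>s < \<kappa>\<close>] s by (simp add: C_def g_def)
    qed (use s n in \<open>simp add: C_def\<close>)
  qed
  have "(\<Sum>i\<in>{i\<in>I. \<kappa> < k i}. r i) + \<delta> / \<kappa> \<le> 1"
  proof (rule tendsto_upperbound[OF lim])
    have "(\<Sum>i\<in>{i\<in>I. \<kappa> < k i}. r i) + \<delta> / s \<le> 1"
      if "\<kappa> < s" "\<forall>i\<in>I. \<kappa> < k i \<longrightarrow> s < k i" for s
    proof -
      have "{i\<in>I. \<kappa> < k i} = {i\<in>I. s \<le> k i}" using that by force
      then show ?thesis using above[OF that(1)] by (simp add: g_def)
    qed
    moreover have "\<forall>\<^sub>F s in at_right \<kappa>. \<forall>i\<in>I. \<kappa> < k i \<longrightarrow> s < k i"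
      by (intro eventually_ball_finite fin ballI)
         (auto simp: eventually_at_right_field intro: gt_ex)
    moreover have "\<forall>\<^sub>F s in at_right \<kappa>. \<kappa> < s" by (rule eventually_at_right_less)
    ultimately show "\<forall>\<^sub>F s in at_right \<kappa>. (\<Sum>i\<in>{i\<in>I. \<kappa> < k i}. r i) + \<delta> / s \<le> 1"
      by (auto elim: eventually_elim2)
  qed auto
  then show ?thesis using that[of \<kappa>] k0 reach above by (simp add: g_def)
qed

text \<open>
With \<open>F s = u + V\<close> at scale \<open>s\<close>, the balance equation is \<open>H s = 0\<close>. Although \<open>u\<close> and \<open>V\<close> both jump
when \<open>s\<close> passes a value \<open>k i\<close>, their sum is continuous.
\<close>
theorem two_point_lower_tail:
  assumes c: "centred I p w k" and w: "\<And>i. i \<in> I \<Longrightarrow> w i \<le> 1" and \<delta>: "0 < \<delta>" "\<delta> \<le> 1"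
  shows "\<delta> * exp (- \<delta>) < below p w k I \<delta>"
proof -
  note cD = centredD[OF c]
  define F where "F s = (\<Sum>i\<in>I. w i * k i / (max s (k i))\<^sup>2)" for s
  have F: "F s = (\<Sum>i\<in>{i\<in>I. s < k i}. w i / k i) + (\<Sum>i\<in>{i\<in>I. k i \<le> s}. w i * k i) / s\<^sup>2"
    if "0 < s" for s
  proof -
    have I: "I = {i\<in>I. s < k i} \<union> {i\<in>I. k i \<le> s}" by auto
    have "F s = (\<Sum>i\<in>{i\<in>I. s < k i}. w i * k i / (max s (k i))\<^sup>2)
        + (\<Sum>i\<in>{i\<in>I. k i \<le> s}. w i * k i / (max s (k i))\<^sup>2)"
      unfolding F_def using cD(1) by (subst I, subst sum.union_disjoint) auto
    also have "(\<Sum>i\<in>{i\<in>I. s < k i}. w i * k i / (max s (k i))\<^sup>2) = (\<Sum>i\<in>{i\<in>I. s < k i}. w i / k i)"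
      by (rule sum.cong) (use that in \<open>auto simp: max_def power2_eq_square\<close>)
    also have "(\<Sum>i\<in>{i\<in>I. k i \<le> s}. w i * k i / (max s (k i))\<^sup>2) = (\<Sum>i\<in>{i\<in>I. k i \<le> s}. w i * k i) / s\<^sup>2"
      unfolding sum_divide_distrib by (rule sum.cong) (auto simp: max_def)
    finally show ?thesis .
  qed
  obtain \<kappa> where \<kappa>: "0 < \<kappa>" "1 \<le> (\<Sum>i\<in>{i\<in>I. \<kappa> \<le> k i}. w i / k i) + \<delta> / \<kappa>"
    "\<And>s. \<kappa> < s \<Longrightarrow> (\<Sum>i\<in>{i\<in>I. s \<le> k i}. w i / k i) + \<delta> / s < 1"
    "(\<Sum>i\<in>{i\<in>I. \<kappa> < k i}. w i / k i) + \<delta> / \<kappa> \<le> 1"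
    by (rule critical_scale_exists[of I "\<lambda>i. w i / k i" \<delta> k]) (use cD \<delta> in auto)
  define H where "H s = \<delta> / s + F s - 1 - 1 / s" for s
  show ?thesis
  proof (cases "H \<kappa> \<le> 0")
    case True
    then show ?thesis
      using \<kappa> by (intro bound_at_critical_scale[OF c \<kappa>(1) \<delta>(1)]) (auto simp: H_def F)
  next
    case False
    define W where "W = (\<Sum>i\<in>I. w i * k i)"
    \<comment> \<open>Any scale that is at least \<open>1\<close> and \<open>W\<close> makes \<open>F \<le> 1\<close>, hence \<open>H \<le> 0\<close> because \<open>\<delta> \<le> 1\<close>.\<close>
    define T where "T = \<kappa> + 1 + W"
    have W: "0 \<le> W" unfolding W_def using cD by (intro sum_nonneg) auto
    have T: "\<kappa> < T" "1 \<le> T" "W \<le> T" using W \<kappa>(1) by (auto simp: T_def)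
    have "H T \<le> 0"
    proof -
      have "F T \<le> (\<Sum>i\<in>I. w i * k i / T\<^sup>2)"
        unfolding F_def using cD T by (intro sum_mono divide_left_mono power_mono) auto
      also have "\<dots> = W / T\<^sup>2" by (simp add: W_def sum_divide_distrib)
      also have "\<dots> \<le> 1"
        using T mult_mono[of 1 T W T] W by (simp add: power2_eq_square divide_simps)
      finally have "F T \<le> 1" .
      moreover have "\<delta> / T \<le> 1 / T" using \<delta> T by (intro divide_right_mono) auto
      ultimately show ?thesis by (simp add: H_def)
    qed
    moreover have "continuous_on {\<kappa>..T} H"
      unfolding H_def F_def using \<kappa>(1) by (intro continuous_intros) auto
    ultimately obtain s where s: "\<kappa> \<le> s" "s \<le> T" "H s = 0"
      using IVT2'[of H T 0 \<kappa>] False T by auto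
    then have "\<kappa> < s" using False by (cases "s = \<kappa>") auto
    have "(\<Sum>i\<in>{i\<in>I. s < k i}. w i / k i) \<le> (\<Sum>i\<in>{i\<in>I. s \<le> k i}. w i / k i)"
      using cD by (intro sum_mono2) auto
    then have "\<delta> / s + (\<Sum>i\<in>{i\<in>I. s < k i}. w i / k i) < 1"
      using \<kappa>(3)[OF \<open>\<kappa> < s\<close>] by linarith
    then show ?thesis
      using s \<kappa>(1) F[of s] by (intro bound_at_balanced_scale[OF c _ w refl refl, of s]) (auto simp: H_def)
  qed
qed

section \<open>Reduction to two-point laws\<close>

definition two_point :: "real \<Rightarrow> real \<Rightarrow> real \<Rightarrow> real \<Rightarrow> bool" where
  "two_point m a b q \<longleftrightarrow> 0 \<le> a \<and> a \<le> m \<and> m \<le> b \<and> 0 \<le> q \<and> q \<le> 1 \<and> (1 - q) * a + q * b = m"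

text \<open>
Suppose that every two-point law with mean \<open>m\<close> gives more than \<open>c\<close>, the expectation of \<open>\<phi> (X)\<close>. Then
all slopes of \<open>\<phi>\<close> from the point \<open>(m, c)\<close> to the left are below all those to the right, so some line
through this point lies below \<open>\<phi>\<close> on the half-line. Its value at \<open>X\<close> has expectation \<open>c\<close> as well, so
\<open>\<phi> (X)\<close> lies on the line almost surely. The atom at \<open>m\<close> is a two-point law too, hence \<open>\<phi> m > c\<close>, and
\<open>X \<noteq> m\<close> almost surely. So \<open>X\<close> takes values on both sides of its mean \<open>m\<close>, and two of them are the
atoms of a law that gives exactly \<open>c\<close>, a contradiction.
\<close>
lemma (in prob_space) two_point_le_expectation:
  fixes X :: "'a \<Rightarrow> real" and \<phi> :: "real \<Rightarrow> real"
  assumes X: "integrable M X" "AE \<omega> in M. 0 \<le> X \<omega>"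
    and \<phi>: "integrable M (\<lambda>\<omega>. \<phi> (X \<omega>))"
  shows "\<exists>a b q. two_point (expectation X) a b q \<and>
    (1 - q) * \<phi> a + q * \<phi> b \<le> expectation (\<lambda>\<omega>. \<phi> (X \<omega>))"
proof (rule ccontr)
  define m where "m = expectation X"
  define c where "c = expectation (\<lambda>\<omega>. \<phi> (X \<omega>))"
  assume "\<not> ?thesis"
  then have no: "c < (1 - q) * \<phi> a + q * \<phi> b" if "two_point m a b q" for a b q
    using that by (force simp: m_def c_def)
  have m0: "0 \<le> m" unfolding m_def using X by (intro integral_nonneg_AE) auto
  have cm: "c < \<phi> m" using no[of m m 0] m0 by (simp add: two_point_def)
  have chord: "c * (b - a) < (b - m) * \<phi> a + (m - a) * \<phi> b" if "0 \<le> a" "a < m" "m < b" for a b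
  proof -
    define q where "q = (m - a) / (b - a)"
    have q1: "q * (b - a) = m - a" using that by (simp add: q_def)
    have "(1 - q) * (b - a) = b - a - q * (b - a)" by (simp add: left_diff_distrib)
    then have q: "q * (b - a) = m - a" "(1 - q) * (b - a) = b - m" unfolding q1 by simp_all
    have "(1 - q) * a + q * b = m" using q by (simp add: algebra_simps)
    moreover have "0 \<le> q" "q \<le> 1" using that by (simp_all add: q_def)
    ultimately have "c < (1 - q) * \<phi> a + q * \<phi> b" using that by (intro no) (simp add: two_point_def)
    then have "c * (b - a) < ((1 - q) * \<phi> a + q * \<phi> b) * (b - a)"
      using that by (intro mult_strict_right_mono) auto
    also have "\<dots> = ((1 - q) * (b - a)) * \<phi> a + (q * (b - a)) * \<phi> b" by (simp add: algebra_simps)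
    finally show ?thesis unfolding q .
  qed
  show False
  \<comment> \<open>Only for \<open>m > 0\<close> does the half-line extend to the left of \<open>m\<close>; otherwise \<open>X\<close> vanishes almost surely.\<close>
  proof (cases "m = 0")
    case True
    have "AE \<omega> in M. X \<omega> = 0"
      using integral_nonneg_eq_0_iff_AE[OF X] True by (simp add: m_def)
    then have "c = expectation (\<lambda>\<omega>. \<phi> 0)"
      unfolding c_def using \<phi> by (intro integral_cong_AE) auto
    then show False using cm True by (simp add: prob_space)
  next
    case False
    then have mpos: "0 < m" using m0 by simp
    define L where "L = (\<lambda>a. (c - \<phi> a) / (m - a)) ` {0..<m}"
    define l where "l = Sup L"
    have ub: "x \<le> (\<phi> b - c) / (b - m)" if x: "x \<in> L" and b: "m < b" for x b
    proof -
      obtain a where a: "0 \<le> a" "a < m" "x = (c - \<phi> a) / (m - a)"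
        using x unfolding L_def by auto
      have "(c - \<phi> a) * (b - m) \<le> (\<phi> b - c) * (m - a)"
        using chord[OF a(1,2) b] by (simp add: algebra_simps)
      then show ?thesis unfolding a(3) using a(2) b by (simp add: pos_divide_le_eq pos_le_divide_eq)
    qed
    have ne: "L \<noteq> {}" using mpos by (simp add: L_def)
    have bdd: "bdd_above L" using ub[of _ "m + 1"] by (auto intro!: bdd_aboveI)
    have support: "0 \<le> \<phi> x - c - l * (x - m)" if "0 \<le> x" for x
    proof (cases x m rule: linorder_cases)
      case less
      then have "(c - \<phi> x) / (m - x) \<le> l"
        unfolding l_def using that by (intro cSup_upper bdd) (auto simp: L_def)
      then show ?thesis using less by (simp add: divide_simps algebra_simps)
    next
      case equal
      then show ?thesis using cm by simp
    next
      case greater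
      then have "l \<le> (\<phi> x - c) / (x - m)"
        unfolding l_def using ne ub by (intro cSup_least) auto
      then show ?thesis using greater by (simp add: divide_simps algebra_simps)
    qed
    have int: "integrable M (\<lambda>\<omega>. \<phi> (X \<omega>) - c - l * (X \<omega> - m))"
      using X \<phi> by simp
    have "expectation (\<lambda>\<omega>. \<phi> (X \<omega>) - c - l * (X \<omega> - m)) = 0"
      using X \<phi> by (simp add: prob_space c_def m_def)
    moreover have "AE \<omega> in M. 0 \<le> \<phi> (X \<omega>) - c - l * (X \<omega> - m)"
      using X(2) support by (auto elim: eventually_mono)
    ultimately have eq: "AE \<omega> in M. \<phi> (X \<omega>) - c - l * (X \<omega> - m) = 0"
      using integral_nonneg_eq_0_iff_AE[OF int] by simp
    have good: "AE \<omega> in M. 0 \<le> X \<omega> \<and> \<phi> (X \<omega>) - c = l * (X \<omega> - m) \<and> X \<omega> \<noteq> m"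
      using X(2) eq by eventually_elim (use cm in auto)
    have "\<exists>a. 0 \<le> a \<and> a < m \<and> \<phi> a - c = l * (a - m)"
    proof (rule ccontr)
      assume n: "\<not> ?thesis"
      have "AE \<omega> in M. m < X \<omega>"
        using good by eventually_elim (use n linorder_neqE_linordered_idom in blast)
      then show False using expectation_greater[OF X(1), of m] by (simp add: m_def)
    qed
    then obtain a where a: "0 \<le> a" "a < m" "\<phi> a - c = l * (a - m)" by blast
    have "\<exists>b. m < b \<and> \<phi> b - c = l * (b - m)"
    proof (rule ccontr)
      assume n: "\<not> ?thesis"
      have "AE \<omega> in M. X \<omega> < m"
        using good by eventually_elim (use n linorder_neqE_linordered_idom in blast)
      then show False using expectation_less[OF X(1), of m] by (simp add: m_def)
    qed
    then obtain b where b: "m < b" "\<phi> b - c = l * (b - m)" by blast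
    have line: "\<phi> a = c + l * (a - m)" "\<phi> b = c + l * (b - m)" using a b by auto
    have "(b - m) * \<phi> a + (m - a) * \<phi> b = c * (b - a)" unfolding line by (simp add: algebra_simps)
    then show False using chord[OF a(1,2) b(1)] by simp
  qed
qed

lemma (in prob_space) indep_var_expectation_iterated:
  fixes X Y :: "'a \<Rightarrow> real" and f :: "real \<times> real \<Rightarrow> real"
  assumes ind: "indep_var borel X borel Y" and f: "f \<in> borel_measurable borel"
    and bd: "\<And>z. \<bar>f z\<bar> \<le> C"
  shows "expectation (\<lambda>\<omega>. f (X \<omega>, Y \<omega>)) = expectation (\<lambda>\<omega>. expectation (\<lambda>\<omega>'. f (X \<omega>, Y \<omega>')))"
proof -
  have X [measurable]: "random_variable borel X" and Y [measurable]: "random_variable borel Y"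
    using ind by (auto dest: indep_var_rv1 indep_var_rv2)
  have f' [measurable]: "f \<in> borel_measurable (borel \<Otimes>\<^sub>M borel)"
    using f by (simp add: borel_prod)
  interpret PX: prob_space "distr M borel X" by (rule prob_space_distr) simp
  interpret PY: prob_space "distr M borel Y" by (rule prob_space_distr) simp
  interpret P: pair_prob_space "distr M borel X" "distr M borel Y" ..
  have "expectation (\<lambda>\<omega>. f (X \<omega>, Y \<omega>)) =
      integral\<^sup>L (distr M (borel \<Otimes>\<^sub>M borel) (\<lambda>\<omega>. (X \<omega>, Y \<omega>))) f"
    by (subst integral_distr) auto
  also have "distr M (borel \<Otimes>\<^sub>M borel) (\<lambda>\<omega>. (X \<omega>, Y \<omega>)) = distr M borel X \<Otimes>\<^sub>M distr M borel Y"
    using ind by (simp add: indep_var_distribution_eq)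
  also have "integral\<^sup>L \<dots> f = (\<integral>x. (\<integral>y. f (x, y) \<partial>distr M borel Y) \<partial>distr M borel X)"
  proof (rule P.integral_fst'[symmetric])
    show "integrable (distr M borel X \<Otimes>\<^sub>M distr M borel Y) f"
      by (rule P.integrable_const_bound[of _ C]) (use bd in \<open>auto simp: cong: measurable_cong_sets\<close>)
  qed
  also have "\<dots> = (\<integral>x. (\<integral>\<omega>'. f (x, Y \<omega>') \<partial>M) \<partial>distr M borel X)"
    by (subst integral_distr) auto
  also have "\<dots> = expectation (\<lambda>\<omega>. expectation (\<lambda>\<omega>'. f (X \<omega>, Y \<omega>')))"
    by (subst integral_distr) auto
  finally show ?thesis .
qed

text \<open>
Induction on the index set. The variable \<open>X j\<close> is replaced first, with \<open>\<phi> x\<close> the expectation of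
\<open>\<psi> (S + x)\<close>, where \<open>S\<close> is the sum of the other variables. The induction hypothesis is then applied to
the mixture \<open>\<psi>'\<close> of two translates of \<open>\<psi>\<close>; this is why \<open>\<psi>\<close> has to be arbitrary.
\<close>
lemma (in prob_space) two_point_reduction:
  fixes X :: "'i \<Rightarrow> 'a \<Rightarrow> real" and \<psi> :: "real \<Rightarrow> real"
  assumes "finite I" and "I \<noteq> {} \<Longrightarrow> indep_vars (\<lambda>_. borel) X I"
    and "\<And>i. i \<in> I \<Longrightarrow> integrable M (X i)" and "\<And>i. i \<in> I \<Longrightarrow> AE \<omega> in M. 0 \<le> X i \<omega>"
    and "\<psi> \<in> borel_measurable borel" and "\<And>x. \<bar>\<psi> x\<bar> \<le> C"
  shows "\<exists>a b q. (\<forall>i\<in>I. two_point (expectation (X i)) (a i) (b i) (q i)) \<and>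
    bern_exp I q (\<lambda>A. \<psi> ((\<Sum>i\<in>A. b i) + (\<Sum>i\<in>I - A. a i)))
      \<le> expectation (\<lambda>\<omega>. \<psi> (\<Sum>i\<in>I. X i \<omega>))"
  using assms
proof (induction I arbitrary: \<psi> rule: finite_induct)
  case empty
  then show ?case by (simp add: prob_space)
next
  case (insert j F)
  define S where "S \<omega> = (\<Sum>i\<in>F. X i \<omega>)" for \<omega>
  note [measurable] = \<open>\<psi> \<in> borel_measurable borel\<close>
  note bd = \<open>\<And>x. \<bar>\<psi> x\<bar> \<le> C\<close>
  have Xj [measurable]: "random_variable borel (X j)"
    using insert.prems(2)[of j] by auto
  have S [measurable]: "random_variable borel S"
    unfolding S_def using insert.prems(2) by (intro borel_measurable_sum) auto
  define \<phi> where "\<phi> x = expectation (\<lambda>\<omega>. \<psi> (S \<omega> + x))" for x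
  have int\<psi>: "integrable M (\<lambda>\<omega>. \<psi> (S \<omega> + x))" for x
    by (rule integrable_const_bound[of _ C]) (use bd in auto)
  have \<phi>m: "\<phi> \<in> borel_measurable borel" unfolding \<phi>_def by measurable
  have bd\<phi>: "\<bar>\<phi> x\<bar> \<le> C" for x
  proof -
    have "\<bar>\<phi> x\<bar> \<le> expectation (\<lambda>\<omega>. \<bar>\<psi> (S \<omega> + x)\<bar>)"
      unfolding \<phi>_def by (rule integral_abs_bound)
    also have "\<dots> \<le> expectation (\<lambda>\<omega>. C)"
      using int\<psi> bd by (intro integral_mono) auto
    finally show ?thesis by (simp add: prob_space)
  qed
  have int\<phi>: "integrable M (\<lambda>\<omega>. \<phi> (X j \<omega>))"
    by (rule integrable_const_bound[of _ C]) (use bd\<phi> \<phi>m in auto)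
  obtain a0 b0 q0 where t0: "two_point (expectation (X j)) a0 b0 q0"
    and le0: "(1 - q0) * \<phi> a0 + q0 * \<phi> b0 \<le> expectation (\<lambda>\<omega>. \<phi> (X j \<omega>))"
    using two_point_le_expectation[of "X j" \<phi>] insert.prems(2,3) int\<phi> by blast
  have ind: "indep_var borel (X j) borel S"
    unfolding S_def using insert by (intro indep_vars_sum) auto
  have iter: "expectation (\<lambda>\<omega>. \<phi> (X j \<omega>)) = expectation (\<lambda>\<omega>. \<psi> (S \<omega> + X j \<omega>))"
  proof -
    have "(\<lambda>z. \<psi> (snd z + fst z)) \<in> borel_measurable borel"
      unfolding borel_prod[symmetric] by measurable
    from indep_var_expectation_iterated[OF ind this, of C] bd
    show ?thesis by (simp add: \<phi>_def)
  qed
  define \<psi>' where "\<psi>' s = (1 - q0) * \<psi> (s + a0) + q0 * \<psi> (s + b0)" for s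
  have q0: "0 \<le> q0" "q0 \<le> 1" using t0 by (auto simp: two_point_def)
  have "\<bar>\<psi>' x\<bar> \<le> C" for x
  proof -
    have "\<bar>\<psi>' x\<bar> \<le> (1 - q0) * \<bar>\<psi> (x + a0)\<bar> + q0 * \<bar>\<psi> (x + b0)\<bar>"
      unfolding \<psi>'_def using q0 by (intro order_trans[OF abs_triangle_ineq]) (simp add: abs_mult)
    also have "\<dots> \<le> (1 - q0) * C + q0 * C"
      using q0 bd by (intro add_mono mult_left_mono) auto
    finally show ?thesis by (simp add: algebra_simps)
  qed
  moreover have "\<psi>' \<in> borel_measurable borel" unfolding \<psi>'_def by measurable
  moreover have "indep_vars (\<lambda>_. borel) X F" if "F \<noteq> {}"
    using insert.prems(1) by (auto intro: indep_vars_subset)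
  ultimately obtain a b q where ab: "\<forall>i\<in>F. two_point (expectation (X i)) (a i) (b i) (q i)"
    and le: "bern_exp F q (\<lambda>A. \<psi>' ((\<Sum>i\<in>A. b i) + (\<Sum>i\<in>F - A. a i))) \<le> expectation (\<lambda>\<omega>. \<psi>' (S \<omega>))"
    using insert.IH[of \<psi>'] insert.prems(2,3) unfolding S_def by auto
  define a' b' q' where "a' = a(j := a0)" and "b' = b(j := b0)" and "q' = q(j := q0)"
  \<comment> \<open>The weights on \<open>F\<close> do not see the value at the new index.\<close>
  have same: "bern_exp F q' f = bern_exp F q f" for f
    unfolding bern_exp_def bern_wt_def q'_def
    using insert.hyps by (intro sum.cong refl arg_cong2[of _ _ _ _ "(*)"] prod.cong) auto
  have out: "(\<Sum>i\<in>A. b' i) + (\<Sum>i\<in>insert j F - A. a' i) = (\<Sum>i\<in>A. b i) + (\<Sum>i\<in>F - A. a i) + a0"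
    if "A \<subseteq> F" for A
  proof -
    have "insert j F - A = insert j (F - A)" using that insert.hyps by auto
    moreover have "(\<Sum>i\<in>A. b' i) = (\<Sum>i\<in>A. b i)" "(\<Sum>i\<in>F - A. a' i) = (\<Sum>i\<in>F - A. a i)"
      using that insert.hyps by (auto intro!: sum.cong simp: a'_def b'_def)
    ultimately show ?thesis using insert.hyps by (simp add: a'_def)
  qed
  have into: "(\<Sum>i\<in>insert j A. b' i) + (\<Sum>i\<in>insert j F - insert j A. a' i)
      = (\<Sum>i\<in>A. b i) + (\<Sum>i\<in>F - A. a i) + b0"
    if "A \<subseteq> F" for A
  proof -
    have "insert j F - insert j A = F - A" "finite A" "j \<notin> A"
      using that insert.hyps finite_subset by auto
    moreover have "(\<Sum>i\<in>A. b' i) = (\<Sum>i\<in>A. b i)" "(\<Sum>i\<in>F - A. a' i) = (\<Sum>i\<in>F - A. a i)"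
      using that insert.hyps by (auto intro!: sum.cong simp: a'_def b'_def)
    ultimately show ?thesis by (simp add: b'_def)
  qed
  have "bern_exp (insert j F) q' (\<lambda>A. \<psi> ((\<Sum>i\<in>A. b' i) + (\<Sum>i\<in>insert j F - A. a' i)))
      = (1 - q0) * bern_exp F q (\<lambda>A. \<psi> ((\<Sum>i\<in>A. b' i) + (\<Sum>i\<in>insert j F - A. a' i)))
      + q0 * bern_exp F q (\<lambda>A. \<psi> ((\<Sum>i\<in>insert j A. b' i) + (\<Sum>i\<in>insert j F - insert j A. a' i)))"
    unfolding bern_exp_insert[OF insert.hyps] same by (simp add: q'_def)
  also have "\<dots> = (1 - q0) * bern_exp F q (\<lambda>A. \<psi> ((\<Sum>i\<in>A. b i) + (\<Sum>i\<in>F - A. a i) + a0))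
      + q0 * bern_exp F q (\<lambda>A. \<psi> ((\<Sum>i\<in>A. b i) + (\<Sum>i\<in>F - A. a i) + b0))"
    by (intro arg_cong2[of _ _ _ _ "(+)"] arg_cong2[of _ _ _ _ "(*)"] bern_exp_cong refl)
      (simp_all only: out into)
  also have "\<dots> = bern_exp F q (\<lambda>A. \<psi>' ((\<Sum>i\<in>A. b i) + (\<Sum>i\<in>F - A. a i)))"
    unfolding \<psi>'_def bern_exp_add bern_exp_cmult ..
  also note le
  also have "expectation (\<lambda>\<omega>. \<psi>' (S \<omega>)) = (1 - q0) * \<phi> a0 + q0 * \<phi> b0"
    unfolding \<psi>'_def \<phi>_def using int\<psi> by simp
  also note le0
  also note iter
  also have "expectation (\<lambda>\<omega>. \<psi> (S \<omega> + X j \<omega>)) = expectation (\<lambda>\<omega>. \<psi> (\<Sum>i\<in>insert j F. X i \<omega>))"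
    using insert.hyps by (simp add: S_def add.commute)
  finally have "bern_exp (insert j F) q' (\<lambda>A. \<psi> ((\<Sum>i\<in>A. b' i) + (\<Sum>i\<in>insert j F - A. a' i)))
      \<le> expectation (\<lambda>\<omega>. \<psi> (\<Sum>i\<in>insert j F. X i \<omega>))" .
  moreover have "\<forall>i\<in>insert j F. two_point (expectation (X i)) (a' i) (b' i) (q' i)"
    using ab t0 by (simp add: a'_def b'_def q'_def)
  ultimately show ?case by blast
qed

section \<open>The lower tail of a sum of independent variables\<close>

lemma (in prob_space) sum_lower_tail:
  fixes X :: "'i \<Rightarrow> 'a \<Rightarrow> real" and \<delta> :: real
  assumes fin: "finite I" and ind: "I \<noteq> {} \<Longrightarrow> indep_vars (\<lambda>_. borel) X I"
    and nn: "\<And>i. i \<in> I \<Longrightarrow> AE \<omega> in M. 0 \<le> X i \<omega>"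
    and int: "\<And>i. i \<in> I \<Longrightarrow> integrable M (X i)"
    and mean: "\<And>i. i \<in> I \<Longrightarrow> expectation (X i) \<le> 1"
    and \<delta>: "0 < \<delta>" "\<delta> \<le> 1"
  shows "\<delta> * exp (- \<delta>) < prob {\<omega> \<in> space M. (\<Sum>i\<in>I. X i \<omega>) < (\<Sum>i\<in>I. expectation (X i)) + \<delta>}"
proof -
  define m where "m i = expectation (X i)" for i
  define t where "t = (\<Sum>i\<in>I. m i) + \<delta>"
  obtain a b q where ab: "\<And>i. i \<in> I \<Longrightarrow> two_point (m i) (a i) (b i) (q i)"
    and le: "bern_exp I q (\<lambda>A. indicator {..<t} ((\<Sum>i\<in>A. b i) + (\<Sum>i\<in>I - A. a i)))
      \<le> expectation (\<lambda>\<omega>. indicator {..<t} (\<Sum>i\<in>I. X i \<omega>))"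
  proof -
    have "\<exists>a b q. (\<forall>i\<in>I. two_point (expectation (X i)) (a i) (b i) (q i)) \<and>
      bern_exp I q (\<lambda>A. indicator {..<t} ((\<Sum>i\<in>A. b i) + (\<Sum>i\<in>I - A. a i)))
        \<le> expectation (\<lambda>\<omega>. indicator {..<t} (\<Sum>i\<in>I. X i \<omega>))"
      using fin ind int nn by (rule two_point_reduction[where C = 1]) (auto simp: indicator_def)
    then show thesis using that unfolding m_def by blast
  qed
  define w k where "w i = m i - a i" and "k i = b i - m i" for i
  have c: "centred I q w k"
    using fin ab by (auto simp: centred_def two_point_def w_def k_def algebra_simps)
  have w1: "w i \<le> 1" if "i \<in> I" for i
    using ab[OF that] mean[OF that] by (simp add: two_point_def w_def m_def)
  have "\<delta> * exp (- \<delta>) < below q w k I \<delta>"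
    by (rule two_point_lower_tail[OF c w1 \<delta>])
  also have "\<dots> = bern_exp I q (\<lambda>A. indicator {..<t} ((\<Sum>i\<in>A. b i) + (\<Sum>i\<in>I - A. a i)))"
  proof (rule bern_exp_cong)
    fix A assume A: "A \<subseteq> I"
    have "(\<Sum>i\<in>I. m i) = (\<Sum>i\<in>A. m i) + (\<Sum>i\<in>I - A. m i)"
      using A fin by (metis add.commute sum.subset_diff)
    then have "(\<Sum>i\<in>A. b i) + (\<Sum>i\<in>I - A. a i) = (\<Sum>i\<in>I. m i) + dev w k I A"
      by (simp add: dev_def w_def k_def sum_subtractf)
    then show "of_bool (dev w k I A < \<delta>) = (indicator {..<t} ((\<Sum>i\<in>A. b i) + (\<Sum>i\<in>I - A. a i)) :: real)"
      by (simp add: t_def indicator_def)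
  qed
  also note le
  also have "expectation (\<lambda>\<omega>. indicator {..<t} (\<Sum>i\<in>I. X i \<omega>)) =
      expectation (indicator {\<omega> \<in> space M. (\<Sum>i\<in>I. X i \<omega>) < t})"
    by (intro Bochner_Integration.integral_cong) (auto simp: indicator_def)
  also have "\<dots> = prob {\<omega> \<in> space M. (\<Sum>i\<in>I. X i \<omega>) < t}"
  proof -
    have "random_variable borel (\<lambda>\<omega>. \<Sum>i\<in>I. X i \<omega>)" using int by (intro borel_measurable_sum) auto
    then have "{\<omega> \<in> space M. (\<Sum>i\<in>I. X i \<omega>) < t} \<in> events" by measurable
    then show ?thesis by simp
  qed
  finally show ?thesis by (simp add: t_def m_def)
qed

theorem corollary1p2:
  fixes M :: "'a measure" and n :: nat and X :: "nat \<Rightarrow> 'a \<Rightarrow> real" and \<delta> :: real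
  assumes "prob_space M"
    and "n \<ge> 1"
    and "prob_space.indep_vars M (\<lambda>_. borel) X {1..n}"
    and "\<And>i. i \<in> {1..n} \<Longrightarrow> AE \<omega> in M. 0 \<le> X i \<omega>"
    and "\<And>i. i \<in> {1..n} \<Longrightarrow> integrable M (X i)"
    and "\<And>i. i \<in> {1..n} \<Longrightarrow> (\<integral>\<omega>. X i \<omega> \<partial>M) \<le> 1"
    and "\<delta> > 0"
  shows "measure M {\<omega> \<in> space M. (\<Sum>i=1..n. X i \<omega>) < (\<integral>\<omega>'. (\<Sum>i=1..n. X i \<omega>') \<partial>M) + \<delta>}
           > (if \<delta> < 1 then \<delta> * exp (- \<delta>) else exp (- 1))"
proof -
  interpret prob_space M by fact
  define d where "d = min \<delta> 1"
  have [measurable]: "\<And>i. i \<in> {1..n} \<Longrightarrow> random_variable borel (X i)" using assms(5) by auto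
  have ES: "expectation (\<lambda>\<omega>. \<Sum>i=1..n. X i \<omega>) = (\<Sum>i=1..n. expectation (X i))"
    using assms(5) by (intro Bochner_Integration.integral_sum) auto
  have "d * exp (- d) < prob {\<omega> \<in> space M. (\<Sum>i=1..n. X i \<omega>) < (\<Sum>i=1..n. expectation (X i)) + d}"
    using assms by (intro sum_lower_tail) (auto simp: d_def)
  also have "\<dots> \<le> prob {\<omega> \<in> space M. (\<Sum>i=1..n. X i \<omega>) < (\<Sum>i=1..n. expectation (X i)) + \<delta>}"
    by (rule finite_measure_mono) (auto simp: d_def)
  finally show ?thesis unfolding ES by (auto simp: d_def min_def split: if_splits)
qed

end
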